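(* There exists an absolute constant $C>0$ such that the following holds. Let $m\ge 1$ be an integer and let $X$ be a random vector valued in $\mathbb{R}^m$ which satisfies $\|X\|_2\le 1$ almost surely. Then for every integer $k\ge 3$ there exists a partition of $\mathbb{R}^m$ into at most $k$ (Borel measurable) sets such that, for the $\sigma$-algebra $\mathcal{F}$ generated by this partition, the conditional expectation $Y=\mathbb{E}[X\mid\mathcal{F}]$ satisfies \[\|\Sigma_X-\Sigma_Y\|_{\mathrm F}\le \frac{C}{\sqrt{\log k}}.\]
   Context: For a square-integrable random vector $V$ in $\mathbb{R}^m$, $\Sigma_V=\mathbb{E}[(V-\mathbb{E}V)(V-\mathbb{E}V)^T]$ is its covariance matrix. $\|A\|_{\mathrm F}=\sqrt{\sum_{i,j}A_{ij}^2}$ is the Frobenius norm, $\|\cdot\|_2$ the Euclidean norm, and $\log$ the natural logarithm. $X$ is identified with its law on $\mathbb{R}^m$. For a partition $\mathbb{R}^m=A_1\sqcup\dots\sqcup A_r$ generating $\mathcal{F}$, $\mathbb{E}[X\mid\mathcal{F}]$ is the random vector equal to $\mathbb{E}[X\mid X\in A_i]$ on the event $\{X\in A_i\}$ (for those $i$ with $\mathbb{P}[X\in A_i]>0$), i.e. the conditional expectation of $X$ given which part $X$ falls into. The constant $C$ does not depend on $m$, $k$, or $X$. *)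

theory Defs
  imports "HOL-Probability.Probability"
begin

text \<open>
  Vectors of \<open>\<real>\<^sup>m\<close> are extensional functions on \<open>{..<m}\<close>, since the absolute constant of the theorem
  has to be chosen before the dimension and so the dimension cannot be a type. The finite product
  \<open>\<sigma>\<close>-algebra is the Borel \<open>\<sigma>\<close>-algebra of \<open>\<real>\<^sup>m\<close>; only the sets, not the measure, of
  \<open>borel_Rn m\<close> are used. The Euclidean norm of \<open>x\<close> is \<open>L2_set x {..<m}\<close>.
\<close>

definition borel_Rn :: "nat \<Rightarrow> (nat \<Rightarrow> real) measure" where
  "borel_Rn m = (\<Pi>\<^sub>M i\<in>{..<m}. borel)"

definition covariance_matrix ::
    "'a measure \<Rightarrow> ('a \<Rightarrow> nat \<Rightarrow> real) \<Rightarrow> nat \<Rightarrow> nat \<Rightarrow> real" where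
  "covariance_matrix M V i j =
     (\<integral>w. (V w i - (\<integral>w'. V w' i \<partial>M)) * (V w j - (\<integral>w'. V w' j \<partial>M)) \<partial>M)"

definition frobenius_norm :: "nat \<Rightarrow> (nat \<Rightarrow> nat \<Rightarrow> real) \<Rightarrow> real" where
  "frobenius_norm m A = sqrt (\<Sum>i<m. \<Sum>j<m. (A i j)\<^sup>2)"

definition vec_cond_exp ::
    "'a measure \<Rightarrow> 'a measure \<Rightarrow> ('a \<Rightarrow> nat \<Rightarrow> real) \<Rightarrow> 'a \<Rightarrow> nat \<Rightarrow> real" where
  "vec_cond_exp M F V w i = real_cond_exp M F (\<lambda>w'. V w' i) w"

text \<open>
  For the \<open>\<sigma>\<close>-algebra generated by a finite partition, the conditional expectation equals
  \<open>E[V | A]\<close> on each part \<open>A\<close> of positive probability.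
\<close>

lemma sigma_sets_partition_Union:
  assumes "partition_on \<Omega> P" and "B \<in> sigma_sets \<Omega> P"
  shows "\<exists>Q\<subseteq>P. B = \<Union>Q"
  using assms(2)
proof (induction rule: sigma_sets.induct)
  case (Basic a)
  then show ?case by (intro exI[of _ "{a}"]) auto
next
  case Empty
  then show ?case by (intro exI[of _ "{}"]) auto
next
  case (Compl a)
  then obtain Q where Q: "Q \<subseteq> P" "a = \<Union>Q" by blast
  have "\<Omega> - a = \<Union>(P - Q)"
  proof (intro equalityI subsetI)
    fix x assume "x \<in> \<Omega> - a"
    then show "x \<in> \<Union>(P - Q)"
      using Q assms(1) by (auto simp: partition_on_def)
  next
    fix x assume "x \<in> \<Union>(P - Q)"
    then obtain A where A: "A \<in> P" "A \<notin> Q" "x \<in> A" by blast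
    have "x \<notin> B" if "B \<in> Q" for B
    proof -
      have "A \<inter> B = {}"
        by (rule disjointD[OF partition_onD2[OF assms(1)]]) (use that A Q(1) in auto)
      with A(3) show ?thesis by blast
    qed
    then show "x \<in> \<Omega> - a"
      using A Q(2) partition_onD1[OF assms(1)] by blast
  qed
  then show ?case by (intro exI[of _ "P - Q"]) auto
next
  case (Union a)
  then obtain Q where Q: "\<And>i. Q i \<subseteq> P" "\<And>i. a i = \<Union>(Q i)" by metis
  then show ?case by (intro exI[of _ "\<Union>(range Q)"]) auto
qed

lemma vec_cond_exp_partition:
  assumes "prob_space M"
    and part: "partition_on (space M) P" "finite P" "P \<subseteq> sets M"
    and int: "integrable M (\<lambda>w. V w i)"
  shows "AE w in M. \<forall>A\<in>P. measure M A > 0 \<longrightarrow> w \<in> A \<longrightarrow>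
     vec_cond_exp M (sigma (space M) P) V w i = (\<integral>w'\<in>A. V w' i \<partial>M) / measure M A"
proof -
  interpret prob_space M by fact
  let ?F = "sigma (space M) P" and ?f = "\<lambda>w. V w i"
  have Pow: "P \<subseteq> Pow (space M)" using part(3) sets.space_closed by blast
  have setsF: "sets ?F = sigma_sets (space M) P" using Pow by simp
  have sub: "subalgebra M ?F"
    using part(3) Pow by (simp add: subalgebra_def sets.sigma_sets_subset)
  interpret finite_measure_subalgebra M ?F by unfold_locales (fact sub)
  define c where "c A = (\<integral>w'\<in>A. ?f w' \<partial>M) / measure M A" for A
  define g where "g w = (\<Sum>A\<in>P. c A * indicator A w)" for w
  have disj: "A \<inter> B = {}" if "A \<in> P" "B \<in> P" "A \<noteq> B" for A B
    using that partition_onD2[OF part(1)] by (simp add: disjointD)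
  have gA: "g w = c A" if "A \<in> P" "w \<in> A" for w A
  proof -
    have "g w = (\<Sum>B\<in>P. if B = A then c A else 0)"
      unfolding g_def
    proof (intro sum.cong refl)
      fix B assume "B \<in> P"
      then show "c B * indicator B w = (if B = A then c A else 0)"
        using that disj[of A B] by (cases "B = A") (auto simp: indicator_def)
    qed
    then show ?thesis using that part(2) by simp
  qed
  have gF: "g \<in> borel_measurable ?F"
  proof -
    have "A \<in> sets ?F" if "A \<in> P" for A using that setsF by auto
    then show ?thesis
      unfolding g_def by (intro borel_measurable_sum borel_measurable_times borel_measurable_indicator) auto
  qed
  have gi: "integrable M g"
    unfolding g_def using part(3)
    by (intro Bochner_Integration.integrable_sum integrable_mult_right integrable_real_indicator)
       (auto simp: emeasure_eq_measure)
  have set_eq: "(\<integral>w\<in>A. ?f w \<partial>M) = (\<integral>w\<in>A. g w \<partial>M)" if A: "A \<in> P" for A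
  proof -
    have As: "A \<in> sets M" using A part(3) by auto
    have "(\<integral>w\<in>A. g w \<partial>M) = (\<integral>w\<in>A. c A \<partial>M)"
      using As gA[OF A] by (intro set_lebesgue_integral_cong) auto
    also have "\<dots> = measure M A * c A"
      using As by (simp add: set_lebesgue_integral_def)
    also have "\<dots> = (\<integral>w\<in>A. ?f w \<partial>M)"
    proof (cases "measure M A = 0")
      case True
      then have "A \<in> null_sets M" using As by (simp add: null_sets_def emeasure_eq_measure)
      then have "AE w in M. w \<notin> A" by (rule AE_not_in)
      then have "(\<integral>w\<in>A. ?f w \<partial>M) = 0"
        unfolding set_lebesgue_integral_def by (intro integral_eq_zero_AE) auto
      with True show ?thesis by simp
    qed (simp add: c_def)
    finally show ?thesis by simp
  qed
  have "AE w in M. real_cond_exp M ?F ?f w = g w"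
  proof (rule real_cond_exp_charact)
    fix B assume "B \<in> sets ?F"
    then obtain Q where Q: "Q \<subseteq> P" "B = \<Union>Q"
      using sigma_sets_partition_Union[OF part(1), of B] setsF by auto
    have finQ: "finite Q" using Q part(2) finite_subset by blast
    have dis: "disjoint_family_on (\<lambda>A. A) Q"
      using Q(1) disj unfolding disjoint_family_on_def by (meson subsetD)
    have si: "set_integrable M A h" if "A \<in> Q" "integrable M h" for A and h :: "'a \<Rightarrow> real"
      using that Q part(3) unfolding set_integrable_def
      by (intro integrable_mult_indicator) auto
    have "(\<integral>w\<in>B. h w \<partial>M) = (\<Sum>A\<in>Q. \<integral>w\<in>A. h w \<partial>M)" if "integrable M h" for h :: "'a \<Rightarrow> real"
      using set_integral_finite_Union[of Q "\<lambda>A. A" M h] finQ dis si that Q part(3) by auto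
    then show "(\<integral>w\<in>B. ?f w \<partial>M) = (\<integral>w\<in>B. g w \<partial>M)"
      using int gi set_eq Q by (auto intro!: sum.cong)
  qed (use int gi gF in auto)
  then show ?thesis
    unfolding vec_cond_exp_def
  proof (rule eventually_mono)
    fix w assume "real_cond_exp M ?F ?f w = g w"
    then show "\<forall>A\<in>P. measure M A > 0 \<longrightarrow> w \<in> A \<longrightarrow>
        real_cond_exp M ?F ?f w = (\<integral>w'\<in>A. V w' i \<partial>M) / measure M A"
      using gA by (simp add: c_def)
  qed
qed

end

theory Submission
  imports Defs
begin

text \<open>
  Let \<open>K(x, y) = \<langle>x, y\<rangle>\<close>. If \<open>K\<close> is close in \<open>L\<^sup>2(\<mu> \<otimes> \<mu>)\<close> to a kernel \<open>(1/n) \<Sum>\<^sub>i f\<^sub>i(x) h\<^sub>i(y)\<close> and the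
  partition makes all the functions \<open>f\<^sub>i\<close>, \<open>h\<^sub>i\<close> measurable, then the Frobenius norm of \<open>\<Sigma>\<^sub>X - \<Sigma>\<^sub>Y\<close> is at most the
  distance of the two kernels, because \<open>X - Y\<close> is orthogonal to everything that the partition sees.
  Randomised rounding writes \<open>K\<close> as an average of products \<open>f(x) h(y)\<close> of integer valued functions with
  bounded fourth moments, so \<open>n\<close> samples give distance of order \<open>1/\<surd>n\<close>. Apart from a set of measure
  \<open>O(1/n)\<close>, the integer vectors \<open>(f\<^sub>i(x), h\<^sub>i(x))\<^sub>i\<close> lie in an \<open>\<ell>\<^sup>1\<close>-ball of radius \<open>O(n)\<close>, hence take only
  \<open>exp(O(n))\<close> values; take \<open>n\<close> of order \<open>log k\<close>.
\<close>

section \<open>Randomised rounding of inner products\<close>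

text \<open>Uniform random signs. They are integers because the rounding below is integer division;
  extensionality keeps the set finite.\<close>

definition sign_vectors :: "nat \<Rightarrow> (nat \<Rightarrow> int) set" where
  "sign_vectors m = {..<m} \<rightarrow>\<^sub>E {-1, 1}"

lemma finite_sign_vectors: "finite (sign_vectors m)"
  unfolding sign_vectors_def by (intro finite_PiE) auto

lemma card_sign_vectors: "card (sign_vectors m) = 2 ^ m"
  unfolding sign_vectors_def by (simp add: card_PiE numeral_2_eq_2)

text \<open>Conditioning on the last sign. Both moment computations below are inductions on the
  dimension through this identity.\<close>

lemma sum_sign_vectors_Suc:
  fixes F :: "(nat \<Rightarrow> int) \<Rightarrow> 'a::comm_monoid_add"
  shows "(\<Sum>e\<in>sign_vectors (Suc m). F e) = (\<Sum>e\<in>sign_vectors m. F (e(m := 1)) + F (e(m := -1)))"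
proof -
  have eq: "sign_vectors (Suc m) = (\<lambda>(y, g). g(m := y)) ` ({-1, 1} \<times> sign_vectors m)"
    unfolding sign_vectors_def lessThan_Suc by (subst PiE_insert_eq) simp
  have inj: "inj_on (\<lambda>(y, g). g(m := y)) ({-1, 1::int} \<times> sign_vectors m)"
    unfolding sign_vectors_def by (rule inj_combinator) simp
  have "(\<Sum>e\<in>sign_vectors (Suc m). F e) = (\<Sum>(y, g)\<in>{-1, 1} \<times> sign_vectors m. F (g(m := y)))"
    unfolding eq by (subst sum.reindex[OF inj]) (auto simp: case_prod_beta intro!: sum.cong)
  also have "\<dots> = (\<Sum>y\<in>{-1, 1}. \<Sum>g\<in>sign_vectors m. F (g(m := y)))"
    by (simp add: sum.cartesian_product)
  also have "\<dots> = (\<Sum>e\<in>sign_vectors m. F (e(m := 1)) + F (e(m := -1)))"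
    by (simp add: sum.distrib add.commute)
  finally show ?thesis .
qed

text \<open>Distinct signs are uncorrelated, so only the diagonal terms survive: in the inductive
  step, the terms linear in the last sign cancel between its two values.\<close>

lemma sign_vectors_inner:
  fixes a b :: "nat \<Rightarrow> int"
  shows "(\<Sum>e\<in>sign_vectors m. (\<Sum>j<m. e j * a j) * (\<Sum>j<m. e j * b j)) = 2 ^ m * (\<Sum>j<m. a j * b j)"
proof (induction m)
  case 0
  then show ?case by simp
next
  case (Suc m)
  have "(\<Sum>e\<in>sign_vectors (Suc m). (\<Sum>j<Suc m. e j * a j) * (\<Sum>j<Suc m. e j * b j))
    = (\<Sum>e\<in>sign_vectors m. 2 * ((\<Sum>j<m. e j * a j) * (\<Sum>j<m. e j * b j)) + 2 * (a m * b m))"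
    by (simp add: sum_sign_vectors_Suc algebra_simps)
  also have "\<dots> = 2 * (\<Sum>e\<in>sign_vectors m. (\<Sum>j<m. e j * a j) * (\<Sum>j<m. e j * b j)) + 2 ^ m * (2 * (a m * b m))"
    by (simp add: sum.distrib sum_distrib_left card_sign_vectors)
  finally show ?case using Suc by (simp add: algebra_simps)
qed

text \<open>Khintchine's inequality for the fourth moment, with the Gaussian constant 3. Odd powers
  of the last term cancel, and the mixed term is evaluated by the second moment.\<close>

lemma sign_vectors_fourth_moment:
  fixes a :: "nat \<Rightarrow> int"
  shows "(\<Sum>e\<in>sign_vectors m. (\<Sum>j<m. e j * a j) ^ 4) \<le> 2 ^ m * (3 * (\<Sum>j<m. (a j)\<^sup>2)\<^sup>2)"
proof (induction m)
  case 0
  then show ?case by simp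
next
  case (Suc m)
  define s where "s e = (\<Sum>j<m. e j * a j)" for e :: "nat \<Rightarrow> int"
  define q where "q = (\<Sum>j<m. (a j)\<^sup>2)"
  have 2: "(\<Sum>e\<in>sign_vectors m. (s e)\<^sup>2) = 2 ^ m * q"
    using sign_vectors_inner[where a = a and b = a] by (simp add: s_def q_def power2_eq_square)
  have "(\<Sum>e\<in>sign_vectors (Suc m). (\<Sum>j<Suc m. e j * a j) ^ 4)
    = (\<Sum>e\<in>sign_vectors m. (s e + a m) ^ 4 + (s e - a m) ^ 4)"
    by (simp add: sum_sign_vectors_Suc s_def)
  also have "\<dots> = (\<Sum>e\<in>sign_vectors m. 2 * (s e) ^ 4 + 12 * (a m)\<^sup>2 * (s e)\<^sup>2 + 2 * (a m) ^ 4)"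
    by (intro sum.cong refl) algebra
  also have "\<dots> = 2 * (\<Sum>e\<in>sign_vectors m. (s e) ^ 4) + 12 * (a m)\<^sup>2 * (2 ^ m * q) + 2 ^ m * (2 * (a m) ^ 4)"
    by (simp add: sum.distrib sum_distrib_left[symmetric] 2 card_sign_vectors)
  \<comment> \<open>Enlarging the coefficient of \<open>(a m) ^ 4\<close> from 2 to 6 completes the
    square.\<close>
  also have "\<dots> \<le> 2 * (2 ^ m * (3 * q\<^sup>2)) + 12 * (a m)\<^sup>2 * (2 ^ m * q) + 2 ^ m * (6 * (a m) ^ 4)"
    using Suc unfolding s_def q_def by (intro add_mono mult_left_mono) auto
  also have "\<dots> = 2 ^ Suc m * (3 * (q + (a m)\<^sup>2)\<^sup>2)"
    by (simp add: power2_eq_square power4_eq_xxxx algebra_simps)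
  finally show ?case by (simp add: q_def)
qed

section \<open>Rounding to integers with a uniform dither\<close>

text \<open>With \<open>z = N * q + r\<close>, precisely the last \<open>r\<close> of the
  \<open>N\<close> shifts reach the next multiple of \<open>N\<close>. Divided by \<open>N\<close>,
  this says that rounding \<open>z / N\<close> down after a uniform shift is exactly
  unbiased.\<close>

lemma sum_div_shift:
  fixes z :: int
  assumes "N > 0"
  shows "(\<Sum>u<N. (z + int u) div int N) = z"
proof -
  define q r where "q = z div int N" and "r = nat (z mod int N)"
  have r: "r < N" "int r = z mod int N" using assms by (simp_all add: r_def nat_less_iff)
  have z: "z = int N * q + int r" unfolding q_def r(2) by simp
  have "(z + int u) div int N = q + (if u \<in> {N - r..<N} then 1 else 0)" if "u < N" for u
  proof -
    have "(z + int u) div int N = q + (int r + int u) div int N"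
      unfolding z using assms by (simp add: add.assoc)
    also have "(int r + int u) div int N = (if u \<in> {N - r..<N} then 1 else 0)"
    proof (cases "r + u < N")
      case True
      then show ?thesis by (auto simp: div_pos_pos_trivial)
    next
      case False
      moreover have "(int r + int u) div int N = 1"
        by (rule int_div_pos_eq[where r = "int r + int u - int N"])
           (use False that r(1) in auto)
      ultimately show ?thesis using that by auto
    qed
    finally show ?thesis .
  qed
  then have "(\<Sum>u<N. (z + int u) div int N) = (\<Sum>u<N. q + (if u \<in> {N - r..<N} then 1 else 0))"
    by (intro sum.cong) auto
  also have "\<dots> = int N * q + int (card ({..<N} \<inter> {N - r..<N}))"
    by (simp add: sum.distrib sum.If_cases del: atLeastLessThan_iff)
  also have "{..<N} \<inter> {N - r..<N} = {N - r..<N}" by auto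
  also have "int N * q + int (card {N - r..<N}) = z" using r(1) z by simp
  finally show ?thesis .
qed

text \<open>The shift adds at least 0 and less than 1 before rounding down, so the result stays
  within 1 of \<open>z / N\<close>.\<close>

lemma abs_div_shift_le:
  fixes z :: int
  assumes "u < N"
  shows "\<bar>real_of_int ((z + int u) div int N)\<bar> \<le> \<bar>real_of_int z / real N\<bar> + 1"
proof -
  have N: "N > 0" using assms by simp
  define d where "d = (z + int u) div int N"
  have "z + int u = d * int N + (z + int u) mod int N"
    "0 \<le> (z + int u) mod int N" "(z + int u) mod int N < int N"
    using N unfolding d_def by simp_all
  then have "d * int N \<le> z + int u" "z + int u < (d + 1) * int N"
    by (simp_all add: distrib_right del: add_diff_cancel_left')
  then have "real_of_int (d * int N) \<le> real_of_int (z + int u)"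
    "real_of_int (z + int u) < real_of_int ((d + 1) * int N)"
    by linarith+
  then have "d * real N \<le> z + real u" "z + real u < (d + 1) * real N"
    by simp_all
  then have "d \<le> z / real N + real u / real N" "z / real N + real u / real N < d + 1"
    using N by (simp_all add: field_simps)
  moreover have "0 \<le> real u / real N" "real u / real N < 1" using assms by auto
  ultimately show ?thesis unfolding d_def[symmetric] by linarith
qed

lemma power2_add_le:
  fixes a b :: real
  shows "(a + b)\<^sup>2 \<le> 2 * a\<^sup>2 + 2 * b\<^sup>2"
  using zero_le_power2[of "a - b"] by (simp add: power2_eq_square algebra_simps)

lemma power4_add_le:
  fixes a b :: real
  shows "(a + b) ^ 4 \<le> 8 * a ^ 4 + 8 * b ^ 4"
proof -
  have "(a + b) ^ 4 = ((a + b)\<^sup>2)\<^sup>2" by simp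
  also have "\<dots> \<le> (2 * a\<^sup>2 + 2 * b\<^sup>2)\<^sup>2" by (intro power_mono power2_add_le) auto
  also have "\<dots> \<le> 2 * (2 * a\<^sup>2)\<^sup>2 + 2 * (2 * b\<^sup>2)\<^sup>2" by (rule power2_add_le)
  finally show ?thesis by simp
qed

lemma abs_le_L2_set:
  assumes "finite A" "i \<in> A"
  shows "\<bar>x i\<bar> \<le> L2_set x A"
proof -
  have "\<bar>x i\<bar> \<le> L2_set (\<lambda>i. \<bar>x i\<bar>) A" by (rule member_le_L2_set[OF assms])
  also have "\<dots> = L2_set x A" by (simp add: L2_set_def)
  finally show ?thesis .
qed

text \<open>
  For \<open>x\<close> rounded to the grid \<open>\<int>/N\<close> and a uniform sign vector \<open>e\<close>, the number \<open>\<langle>e, x\<rangle>\<close> is rounded to an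
  integer with a uniform dither from \<open>{0, 1/N, \<dots>, (N - 1)/N}\<close>. The dither makes the rounding exactly
  unbiased, and \<open>f\<close> and \<open>h\<close> use the same signs but independent dithers, so that the mean of
  \<open>f(x) h(y)\<close> is the inner product of the rounded vectors. The value \<open>0\<close> outside the unit ball keeps the
  moments bounded everywhere.
\<close>

lemma rounded_inner_product:
  assumes "\<delta> > 0"
  obtains \<Omega> :: "((nat \<Rightarrow> int) \<times> nat \<times> nat) set" and f h :: "(nat \<Rightarrow> int) \<times> nat \<times> nat \<Rightarrow> (nat \<Rightarrow> real) \<Rightarrow> int"
  where "finite \<Omega>" "\<Omega> \<noteq> {}"
    "\<And>w. f w \<in> measurable (borel_Rn m) (count_space UNIV)"
    "\<And>w. h w \<in> measurable (borel_Rn m) (count_space UNIV)"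
    "\<And>x. (\<Sum>w\<in>\<Omega>. real_of_int (f w x) ^ 4) \<le> 392 * real (card \<Omega>)"
    "\<And>x. (\<Sum>w\<in>\<Omega>. real_of_int (h w x) ^ 4) \<le> 392 * real (card \<Omega>)"
    "\<And>x y. L2_set x {..<m} \<le> 1 \<Longrightarrow> L2_set y {..<m} \<le> 1 \<Longrightarrow>
      \<bar>(\<Sum>w\<in>\<Omega>. real_of_int (f w x) * real_of_int (h w y)) / card \<Omega> - (\<Sum>j<m. x j * y j)\<bar> \<le> \<delta>"
proof -
  \<comment> \<open>The bound by \<open>m\<close> controls the second moment of the rounded vectors;
    the bound with \<delta> makes an error of \<open>3 / N\<close> per coordinate add up to at most
    \<delta>.\<close>
  obtain N :: nat where N: "real N > max (real m) (3 * real m / \<delta>)" using reals_Archimedean2 by blast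
  have N0: "N > 0" using N by (auto intro: gr0I)
  have mN: "real m \<le> N" "3 * real m / N \<le> \<delta>" using N N0 assms by (auto simp: field_simps)
  define z where "z x j = \<lfloor>real N * x j\<rfloor>" for x :: "nat \<Rightarrow> real" and j
  define Z where "Z e x = (\<Sum>j<m. e j * z x j)" for e :: "nat \<Rightarrow> int" and x
  define r where "r e u x = (if L2_set x {..<m} \<le> 1 then (Z e x + int u) div int N else 0)" for e u x
  define f h where "f = (\<lambda>(e, u, v::nat). r e u)" and "h = (\<lambda>(e, u::nat, v). r e v)"
  define \<Omega> where "\<Omega> = sign_vectors m \<times> {..<N} \<times> {..<N}"
  have \<Omega>: "finite \<Omega>" "card \<Omega> = 2 ^ m * (N * N)"
    unfolding \<Omega>_def by (simp_all add: finite_sign_vectors card_sign_vectors)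
  then have \<Omega>0: "card \<Omega> > 0" using N0 by simp
  have z_approx: "\<bar>real_of_int (z t j) / N - t j\<bar> \<le> 1 / N" for t j
  proof -
    have "real_of_int (z t j) / N - t j = (real_of_int (z t j) - N * t j) / N"
      using N0 by (simp add: field_simps)
    also have "\<bar>\<dots>\<bar> = \<bar>real_of_int (z t j) - N * t j\<bar> / N" by (simp add: abs_divide)
    also have "\<dots> \<le> 1 / N"
      unfolding z_def by (intro divide_right_mono) linarith+
    finally show ?thesis .
  qed
  have r_meas: "r e u \<in> measurable (borel_Rn m) (count_space UNIV)" for e u
  proof -
    have comp: "(\<lambda>x. x j) \<in> borel_measurable (borel_Rn m)" if "j < m" for j
      unfolding borel_Rn_def using that by (intro measurable_component_singleton) simp
    have zm: "(\<lambda>x. real_of_int (z x j)) \<in> borel_measurable (borel_Rn m)" if "j < m" for j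
    proof -
      have "(\<lambda>t. real_of_int \<lfloor>real N * t\<rfloor>) \<in> borel_measurable borel" by measurable
      from measurable_compose[OF comp[OF that] this] show ?thesis unfolding z_def .
    qed
    have "(\<lambda>x. L2_set x {..<m}) \<in> borel_measurable (borel_Rn m)"
      unfolding L2_set_def
      by (intro measurable_compose[OF _ borel_measurable_sqrt]
          borel_measurable_sum borel_measurable_power comp) simp
    then have L2: "{x \<in> space (borel_Rn m). L2_set x {..<m} \<le> 1} \<in> sets (borel_Rn m)"
      unfolding borel_measurable_iff_le by blast
    have "(\<lambda>x. real_of_int (Z e x)) \<in> borel_measurable (borel_Rn m)"
      unfolding Z_def of_int_sum of_int_mult
      by (intro borel_measurable_sum borel_measurable_times zm) auto
    then have "(\<lambda>x. \<lfloor>real_of_int (Z e x)\<rfloor>) \<in> measurable (borel_Rn m) (count_space UNIV)"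
      by (rule measurable_compose[OF _ measurable_real_floor])
    then have "Z e \<in> measurable (borel_Rn m) (count_space UNIV)" by simp
    then have "(\<lambda>x. (Z e x + int u) div int N) \<in> measurable (borel_Rn m) (count_space UNIV)"
      by (rule measurable_compose) simp
    then show ?thesis
      unfolding r_def using L2 by (intro measurable_If) auto
  qed
  \<comment> \<open>After rounding to the grid the squared norm is at most
    \<open>2 * 1 + 2 = 4\<close>, so the signs give fourth moment \<open>3 * 4^2 = 48\<close>.
    Rounding to integers costs at most 1 more, and \<open>power4_add_le\<close> yields
    \<open>392 = 8 * 48 + 8\<close>.\<close>
  have moment: "(\<Sum>e\<in>sign_vectors m. \<Sum>u<N. real_of_int (r e u x) ^ 4) \<le> 392 * (2 ^ m * N)" for x
  proof (cases "L2_set x {..<m} \<le> 1")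
    case True
    have z_sq: "(real_of_int (z x j) / N)\<^sup>2 \<le> 2 * (x j)\<^sup>2 + 2 / N\<^sup>2" for j
    proof -
      define d where "d = real_of_int (z x j) / N - x j"
      have "\<bar>d\<bar> \<le> 1 / N" unfolding d_def by (rule z_approx)
      then have "d\<^sup>2 \<le> (1 / N)\<^sup>2" by (intro power2_le_iff_abs_le[THEN iffD2]) auto
      moreover have "(x j + d)\<^sup>2 \<le> 2 * (x j)\<^sup>2 + 2 * d\<^sup>2"
        by (rule power2_add_le)
      ultimately show ?thesis unfolding d_def by (simp add: power_divide)
    qed
    have "(\<Sum>j<m. (x j)\<^sup>2) \<le> 1"
      using True unfolding L2_set_def by (simp add: real_sqrt_le_1_iff)
    moreover have "real m * (2 / (real N)\<^sup>2) \<le> 2"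
    proof -
      have "real m \<le> real N * real N" using mN(1) N0
        by (metis One_nat_def Suc_leI le_square mult_of_nat_commute of_nat_le_iff of_nat_mult order_trans)
      then show ?thesis using N0 by (simp add: field_simps power2_eq_square)
    qed
    moreover have "(\<Sum>j<m. (real_of_int (z x j) / N)\<^sup>2) \<le> (\<Sum>j<m. 2 * (x j)\<^sup>2 + 2 / N\<^sup>2)"
      by (intro sum_mono z_sq)
    moreover have "\<dots> = 2 * (\<Sum>j<m. (x j)\<^sup>2) + real m * (2 / (real N)\<^sup>2)"
      by (simp add: sum.distrib sum_distrib_left)
    ultimately have q: "(\<Sum>j<m. (real_of_int (z x j) / N)\<^sup>2) \<le> 4" by linarith
    have "real_of_int (\<Sum>e\<in>sign_vectors m. Z e x ^ 4) \<le> real_of_int (2 ^ m * (3 * (\<Sum>j<m. (z x j)\<^sup>2)\<^sup>2))"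
      unfolding Z_def by (intro of_int_le_iff[THEN iffD2] sign_vectors_fourth_moment)
    then have "(\<Sum>e\<in>sign_vectors m. real_of_int (Z e x) ^ 4) / N ^ 4
        \<le> 2 ^ m * (3 * (\<Sum>j<m. (real_of_int (z x j))\<^sup>2)\<^sup>2) / N ^ 4"
      by (intro divide_right_mono) simp_all
    also have "\<dots> = 2 ^ m * (3 * (\<Sum>j<m. (real_of_int (z x j) / N)\<^sup>2)\<^sup>2)"
      by (simp add: power_divide sum_divide_distrib[symmetric] power_mult[symmetric])
    also have "\<dots> \<le> 2 ^ m * (3 * 4\<^sup>2)"
      using q by (intro mult_left_mono power_mono sum_nonneg) auto
    finally have Z4: "(\<Sum>e\<in>sign_vectors m. (real_of_int (Z e x) / N) ^ 4) \<le> 48 * 2 ^ m"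
      by (simp add: power_divide sum_divide_distrib)
    have "(\<Sum>e\<in>sign_vectors m. \<Sum>u<N. real_of_int (r e u x) ^ 4)
        \<le> (\<Sum>e\<in>sign_vectors m. \<Sum>u<N. 8 * (real_of_int (Z e x) / N) ^ 4 + 8)"
    proof (intro sum_mono)
      fix e u assume "u \<in> {..<N}"
      then have "\<bar>real_of_int (r e u x)\<bar> \<le> \<bar>real_of_int (Z e x) / N\<bar> + 1"
        using True abs_div_shift_le[of u N "Z e x"] unfolding r_def by simp
      then have "\<bar>real_of_int (r e u x)\<bar> ^ 4 \<le> (\<bar>real_of_int (Z e x) / N\<bar> + 1) ^ 4"
        by (intro power_mono) auto
      also have "\<dots> \<le> 8 * \<bar>real_of_int (Z e x) / N\<bar> ^ 4 + 8 * 1 ^ 4" by (rule power4_add_le)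
      finally show "real_of_int (r e u x) ^ 4 \<le> 8 * (real_of_int (Z e x) / N) ^ 4 + 8"
        by (simp add: power_even_abs power_divide)
    qed
    also have "\<dots> = N * (8 * (\<Sum>e\<in>sign_vectors m. (real_of_int (Z e x) / N) ^ 4) + 8 * 2 ^ m)"
      by (simp add: sum.distrib sum_distrib_left card_sign_vectors algebra_simps)
    also have "\<dots> \<le> real N * (8 * (48 * 2 ^ m) + 8 * 2 ^ m)"
      by (intro mult_left_mono add_mono Z4) auto
    finally show ?thesis by (simp add: mult_ac)
  qed (simp add: r_def)
  \<comment> \<open>\<open>f\<close> sees only the first dither; summing over the second one
    contributes the factor \<open>N\<close>.\<close>
  have "(\<Sum>w\<in>\<Omega>. real_of_int (f w x) ^ 4) = N * (\<Sum>e\<in>sign_vectors m. \<Sum>u<N. real_of_int (r e u x) ^ 4)" for x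
    unfolding \<Omega>_def f_def sum.cartesian_product' by (simp add: sum_distrib_left)
  then have f4: "(\<Sum>w\<in>\<Omega>. real_of_int (f w x) ^ 4) \<le> 392 * real (card \<Omega>)" for x
    using mult_left_mono[OF moment[of x], of "real N"] \<Omega>(2) by (simp add: mult_ac)
  have "(\<Sum>w\<in>\<Omega>. real_of_int (h w x) ^ 4) = N * (\<Sum>e\<in>sign_vectors m. \<Sum>u<N. real_of_int (r e u x) ^ 4)" for x
    unfolding \<Omega>_def h_def sum.cartesian_product' by (simp add: sum_distrib_left)
  then have h4: "(\<Sum>w\<in>\<Omega>. real_of_int (h w x) ^ 4) \<le> 392 * real (card \<Omega>)" for x
    using mult_left_mono[OF moment[of x], of "real N"] \<Omega>(2) by (simp add: mult_ac)
  have approx: "\<bar>(\<Sum>w\<in>\<Omega>. real_of_int (f w x) * real_of_int (h w y)) / card \<Omega> - (\<Sum>j<m. x j * y j)\<bar> \<le> \<delta>"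
    if xy: "L2_set x {..<m} \<le> 1" "L2_set y {..<m} \<le> 1" for x y
  proof -
    \<comment> \<open>For fixed signs the dithers are independent, so the sum factorises.
      \<open>sum_div_shift\<close> removes each dither, and the uncorrelated signs then leave the
      inner product of the grid vectors.\<close>
    have "(\<Sum>w\<in>\<Omega>. f w x * h w y) = (\<Sum>e\<in>sign_vectors m. (\<Sum>u<N. r e u x) * (\<Sum>v<N. r e v y))"
      unfolding \<Omega>_def f_def h_def sum.cartesian_product' by (simp add: sum_product)
    also have "\<dots> = (\<Sum>e\<in>sign_vectors m. Z e x * Z e y)"
      using xy N0 unfolding r_def by (simp add: sum_div_shift)
    also have "\<dots> = 2 ^ m * (\<Sum>j<m. z x j * z y j)"
      unfolding Z_def by (rule sign_vectors_inner)
    finally have "real_of_int (\<Sum>w\<in>\<Omega>. f w x * h w y) = real_of_int (2 ^ m * (\<Sum>j<m. z x j * z y j))"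
      by simp
    then have "(\<Sum>w\<in>\<Omega>. real_of_int (f w x) * real_of_int (h w y)) / card \<Omega>
        = (\<Sum>j<m. (z x j / N) * (z y j / N))"
      unfolding \<Omega>(2) using N0 by (simp add: sum_divide_distrib[symmetric] field_simps)
    then have "\<bar>(\<Sum>w\<in>\<Omega>. real_of_int (f w x) * real_of_int (h w y)) / card \<Omega> - (\<Sum>j<m. x j * y j)\<bar>
        = \<bar>\<Sum>j<m. (z x j / N) * (z y j / N) - x j * y j\<bar>"
      by (simp add: sum_subtractf)
    also have "\<dots> \<le> (\<Sum>j<m. \<bar>(z x j / N) * (z y j / N) - x j * y j\<bar>)" by (rule sum_abs)
    also have "\<dots> \<le> (\<Sum>j<m. 3 / N)"
    proof (intro sum_mono)
      fix j assume j: "j \<in> {..<m}"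
      have le1: "\<bar>t j\<bar> \<le> 1" if "L2_set t {..<m} \<le> 1" for t :: "nat \<Rightarrow> real"
        using abs_le_L2_set[of "{..<m}" j t] j that by simp
      \<comment> \<open>In terms of the two rounding errors the product error has three terms, each
        at most \<open>1 / N\<close>; in \<open>a * b\<close> one factor is bounded by 1.\<close>
      define a b where "a = z x j / N - x j" and "b = z y j / N - y j"
      have "(z x j / N) * (z y j / N) - x j * y j = a * y j + (x j * b + a * b)"
        unfolding a_def b_def by (simp add: algebra_simps)
      also have "\<bar>\<dots>\<bar> \<le> \<bar>a\<bar> * \<bar>y j\<bar> + (\<bar>x j\<bar> * \<bar>b\<bar> + \<bar>a\<bar> * \<bar>b\<bar>)"
        unfolding abs_mult[symmetric] by linarith
      also have "\<dots> \<le> 1 / N * 1 + (1 * (1 / N) + 1 / N * 1)"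
      proof (intro add_mono mult_mono)
        have "1 / real N \<le> 1" using N0 by simp
        then show "\<bar>b\<bar> \<le> 1" using z_approx[of y j] unfolding b_def by linarith
      qed (use z_approx le1 xy in \<open>auto simp: a_def b_def\<close>)
      finally show "\<bar>(z x j / N) * (z y j / N) - x j * y j\<bar> \<le> 3 / N" by simp
    qed
    also have "\<dots> \<le> \<delta>" using mN(2) by (simp add: mult.commute)
    finally show ?thesis .
  qed
  show thesis
  proof (rule that[of \<Omega> f h])
    show "\<Omega> \<noteq> {}" using \<Omega>0 by auto
    show "f w \<in> measurable (borel_Rn m) (count_space UNIV)" for w
      unfolding f_def by (cases w) (simp add: r_meas)
    show "h w \<in> measurable (borel_Rn m) (count_space UNIV)" for w
      unfolding h_def by (cases w) (simp add: r_meas)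
  qed (use \<Omega>(1) f4 h4 approx in auto)
qed

section \<open>Greedy sampling\<close>

text \<open>The variance is at most the second moment, so centring the samples preserves the moment
  bounds.\<close>

lemma sum_squared_deviation_le:
  fixes g :: "'w \<Rightarrow> real"
  assumes "finite \<Omega>" "\<Omega> \<noteq> {}"
  shows "(\<Sum>w\<in>\<Omega>. (g w - (\<Sum>w\<in>\<Omega>. g w) / card \<Omega>)\<^sup>2) \<le> (\<Sum>w\<in>\<Omega>. (g w)\<^sup>2)"
proof -
  define a where "a = (\<Sum>w\<in>\<Omega>. g w) / card \<Omega>"
  have c: "real (card \<Omega>) > 0" using assms by (simp add: card_gt_0_iff)
  then have s: "(\<Sum>w\<in>\<Omega>. g w) = card \<Omega> * a" unfolding a_def by simp
  have "(\<Sum>w\<in>\<Omega>. (g w - a)\<^sup>2) = (\<Sum>w\<in>\<Omega>. (g w)\<^sup>2) - 2 * a * (\<Sum>w\<in>\<Omega>. g w) + card \<Omega> * a\<^sup>2"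
    by (simp add: power2_diff sum.distrib sum_subtractf sum_distrib_left sum_distrib_right mult_ac)
  also have "\<dots> = (\<Sum>w\<in>\<Omega>. (g w)\<^sup>2) - card \<Omega> * a\<^sup>2"
    unfolding s by (simp add: power2_eq_square)
  finally show ?thesis unfolding a_def[symmetric] by simp
qed

lemma sum_deviation_eq_0:
  fixes g :: "'w \<Rightarrow> real"
  assumes "finite \<Omega>" "\<Omega> \<noteq> {}"
  shows "(\<Sum>w\<in>\<Omega>. g w - (\<Sum>w\<in>\<Omega>. g w) / card \<Omega>) = 0"
  using assms by (simp add: sum_subtractf)

text \<open>
  Each new sample is chosen so that the total second moment of the partial sums grows by at most its
  average increment; centring kills the cross terms. This replaces independent sampling.
\<close>

lemma greedy_selection:
  fixes q :: "'b \<Rightarrow> 'w \<Rightarrow> 'a \<Rightarrow> real"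
  assumes "finite_measure M"
    and fin: "finite \<Omega>" "\<Omega> \<noteq> {}" "finite I"
    and meas: "\<And>b w. b \<in> I \<Longrightarrow> w \<in> \<Omega> \<Longrightarrow> q b w \<in> borel_measurable M"
    and bounded: "\<And>b w x. b \<in> I \<Longrightarrow> w \<in> \<Omega> \<Longrightarrow> \<bar>q b w x\<bar> \<le> B"
    and mean: "\<And>b x. b \<in> I \<Longrightarrow> (\<Sum>w\<in>\<Omega>. q b w x) = 0"
    and second_moment: "(\<Sum>w\<in>\<Omega>. \<Sum>b\<in>I. \<integral>x. (q b w x)\<^sup>2 \<partial>M) \<le> real (card \<Omega>) * c"
  shows "\<exists>\<sigma>. (\<forall>i. \<sigma> i \<in> \<Omega>) \<and> (\<Sum>b\<in>I. \<integral>x. (\<Sum>i<n. q b (\<sigma> i) x)\<^sup>2 \<partial>M) \<le> real n * c"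
proof (induction n)
  case 0
  then show ?case using fin(2) by auto
next
  case (Suc n)
  interpret finite_measure M by fact
  from Suc obtain \<sigma> where \<sigma>: "\<And>i. \<sigma> i \<in> \<Omega>"
    and IH: "(\<Sum>b\<in>I. \<integral>x. (\<Sum>i<n. q b (\<sigma> i) x)\<^sup>2 \<partial>M) \<le> real n * c" by blast
  define R where "R b x = (\<Sum>i<n. q b (\<sigma> i) x)" for b x
  define \<Phi> where "\<Phi> w = (\<Sum>b\<in>I. \<integral>x. (R b x + q b w x)\<^sup>2 \<partial>M)" for w
  have Rm: "R b \<in> borel_measurable M" if "b \<in> I" for b
    unfolding R_def using that \<sigma> by (intro borel_measurable_sum meas) auto
  have Rb: "\<bar>R b x\<bar> \<le> real n * B" if "b \<in> I" for b x
  proof -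
    have "\<bar>R b x\<bar> \<le> (\<Sum>i<n. \<bar>q b (\<sigma> i) x\<bar>)" unfolding R_def by (rule sum_abs)
    also have "\<dots> \<le> (\<Sum>i<n. B)" using that \<sigma> by (intro sum_mono bounded) auto
    finally show ?thesis by simp
  qed
  have prod_int: "integrable M (\<lambda>x. f x * g x)"
    if "f \<in> borel_measurable M" "g \<in> borel_measurable M" "\<And>x. \<bar>f x\<bar> \<le> F" "\<And>x. \<bar>g x\<bar> \<le> G"
    for f g :: "'a \<Rightarrow> real" and F G
  proof (rule integrable_const_bound[where B = "F * G"])
    \<comment> \<open>The bound holds at every point, so evaluating it at any one of them gives its
      sign.\<close>
    have "F \<ge> 0" using that(3)[of undefined] by linarith
    then show "AE x in M. norm (f x * g x) \<le> F * G"
      using that(3,4) by (auto simp: abs_mult intro!: mult_mono)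
  qed (use that in measurable)
  have RR: "integrable M (\<lambda>x. (R b x)\<^sup>2)" if "b \<in> I" for b
    unfolding power2_eq_square using prod_int[OF Rm Rm Rb Rb] that by blast
  have Rq: "integrable M (\<lambda>x. R b x * q b w x)" if "b \<in> I" "w \<in> \<Omega>" for b w
    using prod_int[OF Rm meas Rb bounded] that by blast
  have qq: "integrable M (\<lambda>x. (q b w x)\<^sup>2)" if "b \<in> I" "w \<in> \<Omega>" for b w
    unfolding power2_eq_square using prod_int[OF meas meas bounded bounded] that by blast
  have cross: "(\<Sum>w\<in>\<Omega>. \<integral>x. R b x * q b w x \<partial>M) = 0" if "b \<in> I" for b
  proof -
    have "(\<Sum>w\<in>\<Omega>. \<integral>x. R b x * q b w x \<partial>M) = (\<integral>x. (\<Sum>w\<in>\<Omega>. R b x * q b w x) \<partial>M)"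
      using Rq that by (subst Bochner_Integration.integral_sum) auto
    also have "\<dots> = 0" using that by (simp add: sum_distrib_left[symmetric] mean)
    finally show ?thesis .
  qed
  have "(\<Sum>w\<in>\<Omega>. \<Phi> w) = (\<Sum>w\<in>\<Omega>. \<Sum>b\<in>I. (\<integral>x. (R b x)\<^sup>2 \<partial>M)
      + 2 * (\<integral>x. R b x * q b w x \<partial>M) + (\<integral>x. (q b w x)\<^sup>2 \<partial>M))"
    unfolding \<Phi>_def
  proof (intro sum.cong refl)
    fix w b assume wb: "w \<in> \<Omega>" "b \<in> I"
    have "(\<integral>x. (R b x + q b w x)\<^sup>2 \<partial>M) = (\<integral>x. (R b x)\<^sup>2 + 2 * (R b x * q b w x) + (q b w x)\<^sup>2 \<partial>M)"
      by (simp add: power2_sum algebra_simps)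
    then show "(\<integral>x. (R b x + q b w x)\<^sup>2 \<partial>M) = (\<integral>x. (R b x)\<^sup>2 \<partial>M)
        + 2 * (\<integral>x. R b x * q b w x \<partial>M) + (\<integral>x. (q b w x)\<^sup>2 \<partial>M)"
      using RR Rq qq wb by simp
  qed
  also have "\<dots> = real (card \<Omega>) * (\<Sum>b\<in>I. \<integral>x. (R b x)\<^sup>2 \<partial>M)
      + 2 * (\<Sum>b\<in>I. \<Sum>w\<in>\<Omega>. \<integral>x. R b x * q b w x \<partial>M) + (\<Sum>w\<in>\<Omega>. \<Sum>b\<in>I. \<integral>x. (q b w x)\<^sup>2 \<partial>M)"
    by (subst sum.swap[of _ \<Omega> I]) (simp add: sum.distrib sum_distrib_left)
  also have "\<dots> \<le> real (card \<Omega>) * (real n * c) + 2 * 0 + real (card \<Omega>) * c"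
    using IH second_moment cross unfolding R_def by (intro add_mono mult_left_mono) auto
  also have "\<dots> = (\<Sum>w\<in>\<Omega>. real (Suc n) * c)" by (simp add: algebra_simps)
  finally have "(\<Sum>w\<in>\<Omega>. \<Phi> w) \<le> (\<Sum>w\<in>\<Omega>. real (Suc n) * c)" .
  \<comment> \<open>If every choice exceeded the average increment, so would the sum; hence some
    \<open>w\<close> respects the bound.\<close>
  then obtain w where w: "w \<in> \<Omega>" "\<Phi> w \<le> real (Suc n) * c"
    using sum_strict_mono[OF fin(1,2), of "\<lambda>_. real (Suc n) * c" \<Phi>] by (meson not_le)
  show ?case
  proof (intro exI[of _ "\<sigma>(n := w)"] conjI allI)
    show "(\<sigma>(n := w)) i \<in> \<Omega>" for i using w(1) \<sigma> by simp
    show "(\<Sum>b\<in>I. \<integral>x. (\<Sum>i<Suc n. q b ((\<sigma>(n := w)) i) x)\<^sup>2 \<partial>M) \<le> real (Suc n) * c"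
      using w(2) unfolding \<Phi>_def R_def by simp
  qed
qed

section \<open>Covariance loss and kernel approximation\<close>

lemma (in pair_sigma_finite)
  fixes f :: "'a \<Rightarrow> real" and g :: "'b \<Rightarrow> real"
  assumes f: "integrable M1 f" and g: "integrable M2 g"
  shows integrable_tensor: "integrable (M1 \<Otimes>\<^sub>M M2) (\<lambda>p. f (fst p) * g (snd p))"
    and integral_tensor: "(\<integral>p. f (fst p) * g (snd p) \<partial>(M1 \<Otimes>\<^sub>M M2)) = (\<integral>x. f x \<partial>M1) * (\<integral>y. g y \<partial>M2)"
proof -
  have [measurable]: "f \<in> borel_measurable M1" "g \<in> borel_measurable M2" using f g by auto
  show int: "integrable (M1 \<Otimes>\<^sub>M M2) (\<lambda>p. f (fst p) * g (snd p))"
    by (rule Fubini_integrable) (use f g in \<open>auto simp: abs_mult\<close>)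
  show "(\<integral>p. f (fst p) * g (snd p) \<partial>(M1 \<Otimes>\<^sub>M M2)) = (\<integral>x. f x \<partial>M1) * (\<integral>y. g y \<partial>M2)"
    using integral_fst'[OF int] f g by simp
qed

lemma (in pair_prob_space) AE_pair_both:
  assumes P: "AE x in M1. P x" and Q: "AE y in M2. Q y"
  shows "AE p in M1 \<Otimes>\<^sub>M M2. P (fst p) \<and> Q (snd p)"
proof -
  obtain N1 where N1: "{x \<in> space M1. \<not> P x} \<subseteq> N1" "emeasure M1 N1 = 0" "N1 \<in> sets M1"
    using P by (rule AE_E)
  obtain N2 where N2: "{y \<in> space M2. \<not> Q y} \<subseteq> N2" "emeasure M2 N2 = 0" "N2 \<in> sets M2"
    using Q by (rule AE_E)
  have 1: "N1 \<times> space M2 \<in> null_sets (M1 \<Otimes>\<^sub>M M2)"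
    using N1 by (auto simp: null_sets_def M2.emeasure_pair_measure_Times)
  have 2: "space M1 \<times> N2 \<in> null_sets (M1 \<Otimes>\<^sub>M M2)"
    using N2 by (auto simp: null_sets_def M2.emeasure_pair_measure_Times)
  show ?thesis
    by (rule AE_I'[OF null_sets.Un[OF 1 2]]) (use N1(1) N2(1) in \<open>auto simp: space_pair_measure\<close>)
qed

text \<open>The product of two finite-rank kernels is a sum of tensors, for which Fubini separates
  the variables. The integrability statements and pairings in the kernel comparison below come from
  here.\<close>

lemma (in prob_space)
  fixes F G :: "'i \<Rightarrow> 'a \<Rightarrow> real" and F' G' :: "'j \<Rightarrow> 'a \<Rightarrow> real"
  assumes F: "\<And>i j. i \<in> I \<Longrightarrow> j \<in> J \<Longrightarrow> integrable M (\<lambda>x. F i x * F' j x)"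
    and G: "\<And>i j. i \<in> I \<Longrightarrow> j \<in> J \<Longrightarrow> integrable M (\<lambda>x. G i x * G' j x)"
  defines "W \<equiv> \<lambda>p. (\<Sum>i\<in>I. F i (fst p) * G i (snd p)) * (\<Sum>j\<in>J. F' j (fst p) * G' j (snd p))"
  shows integrable_tensor_sums: "integrable (M \<Otimes>\<^sub>M M) W"
    and integral_tensor_sums_eq: "(\<integral>p. W p \<partial>(M \<Otimes>\<^sub>M M))
      = (\<Sum>i\<in>I. \<Sum>j\<in>J. (\<integral>x. F i x * F' j x \<partial>M) * (\<integral>x. G i x * G' j x \<partial>M))"
proof -
  interpret pair_sigma_finite M M ..
  have W: "W = (\<lambda>p. \<Sum>i\<in>I. \<Sum>j\<in>J. (F i (fst p) * F' j (fst p)) * (G i (snd p) * G' j (snd p)))"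
    unfolding W_def by (simp add: sum_product mult_ac)
  note tensor = integrable_tensor[OF F G] integral_tensor[OF F G]
  show "integrable (M \<Otimes>\<^sub>M M) W"
    unfolding W by (intro Bochner_Integration.integrable_sum tensor(1))
  show "(\<integral>p. W p \<partial>(M \<Otimes>\<^sub>M M))
      = (\<Sum>i\<in>I. \<Sum>j\<in>J. (\<integral>x. F i x * F' j x \<partial>M) * (\<integral>x. G i x * G' j x \<partial>M))"
    unfolding W using tensor
    by (simp add: Bochner_Integration.integral_sum Bochner_Integration.integrable_sum)
qed

text \<open>The coordinates of \<open>X\<close> are bounded only almost surely and conditional
  expectations are determined only almost surely. This class contains both, and on a probability
  space products of two members are integrable.\<close>

definition AE_bounded :: "'a measure \<Rightarrow> ('a \<Rightarrow> real) \<Rightarrow> bool" where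
  "AE_bounded M f \<longleftrightarrow> f \<in> borel_measurable M \<and> (\<exists>B. AE x in M. \<bar>f x\<bar> \<le> B)"

lemma AE_boundedI: "f \<in> borel_measurable M \<Longrightarrow> AE x in M. \<bar>f x\<bar> \<le> B \<Longrightarrow> AE_bounded M f"
  unfolding AE_bounded_def by blast

lemma AE_bounded_diff:
  assumes "AE_bounded M f" "AE_bounded M g"
  shows "AE_bounded M (\<lambda>x. f x - g x)"
proof -
  from assms obtain A B where [measurable]: "f \<in> borel_measurable M" "g \<in> borel_measurable M"
    and AB: "AE x in M. \<bar>f x\<bar> \<le> A" "AE x in M. \<bar>g x\<bar> \<le> B" unfolding AE_bounded_def by blast
  from AB have "AE x in M. \<bar>f x - g x\<bar> \<le> A + B" by eventually_elim linarith
  then show ?thesis by (intro AE_boundedI) measurable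
qed

lemma (in prob_space) integrable_mult_AE_bounded:
  assumes "AE_bounded M f" "AE_bounded M g"
  shows "integrable M (\<lambda>x. f x * g x)"
proof -
  from assms obtain A B where [measurable]: "f \<in> borel_measurable M" "g \<in> borel_measurable M"
    and AB: "AE x in M. \<bar>f x\<bar> \<le> A" "AE x in M. \<bar>g x\<bar> \<le> B" unfolding AE_bounded_def by blast
  from AB have "AE x in M. norm (f x * g x) \<le> A * B"
    by eventually_elim (auto simp: abs_mult intro!: mult_mono)
  then show ?thesis by (rule integrable_const_bound) measurable
qed

lemma (in prob_space) covariance_matrix_alt:
  assumes "AE_bounded M (\<lambda>w. V w i)" "AE_bounded M (\<lambda>w. V w j)"
  shows "covariance_matrix M V i j
    = (\<integral>w. V w i * V w j \<partial>M) - (\<integral>w. V w i \<partial>M) * (\<integral>w. V w j \<partial>M)"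
proof -
  let ?a = "\<integral>w. V w i \<partial>M" and ?b = "\<integral>w. V w j \<partial>M"
  have one: "AE_bounded M (\<lambda>w. 1)" by (rule AE_boundedI[where B = 1]) auto
  have [simp]: "integrable M (\<lambda>w. V w i * V w j)" "integrable M (\<lambda>w. V w i)" "integrable M (\<lambda>w. V w j)"
    using integrable_mult_AE_bounded[OF assms] integrable_mult_AE_bounded[OF assms(1) one]
      integrable_mult_AE_bounded[OF assms(2) one] by simp_all
  have "covariance_matrix M V i j = (\<integral>w. V w i * V w j - ?b * V w i - ?a * V w j + ?a * ?b \<partial>M)"
    unfolding covariance_matrix_def by (simp add: algebra_simps)
  also have "\<dots> = (\<integral>w. V w i * V w j \<partial>M) - ?b * ?a - ?a * ?b + ?a * ?b"
    by (simp add: prob_space)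
  finally show ?thesis by simp
qed

text \<open>
  Write \<open>D = X - Y\<close> and \<open>W(x, y) = \<langle>D x, D y\<rangle>\<close>. Both \<open>\<integral>W\<^sup>2\<close> and \<open>\<integral>W\<kappa>\<close>, with \<open>\<kappa>\<close> the integrand of the
  right hand side, are equal to the left hand side: \<open>D\<close> is orthogonal to everything measurable
  in \<open>F\<close>. Now expand \<open>\<integral>(W - \<kappa>)\<^sup>2 \<ge> 0\<close>.
\<close>

lemma covariance_loss_le_kernel_approximation:
  fixes X :: "'a \<Rightarrow> nat \<Rightarrow> real" and f h :: "'l \<Rightarrow> 'a \<Rightarrow> real"
  assumes "prob_space M" and sub: "subalgebra M F"
    and X: "\<And>i. i < m \<Longrightarrow> AE_bounded M (\<lambda>w. X w i)"
    and f: "\<And>l. l \<in> J \<Longrightarrow> f l \<in> borel_measurable F" "\<And>l. l \<in> J \<Longrightarrow> AE_bounded M (f l)"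
    and h: "\<And>l. l \<in> J \<Longrightarrow> h l \<in> borel_measurable F" "\<And>l. l \<in> J \<Longrightarrow> AE_bounded M (h l)"
  shows "(frobenius_norm m (\<lambda>i j. covariance_matrix M X i j
        - covariance_matrix M (vec_cond_exp M F X) i j))\<^sup>2
     \<le> (\<integral>p. ((\<Sum>i<m. X (fst p) i * X (snd p) i) - (\<Sum>l\<in>J. f l (fst p) * h l (snd p)))\<^sup>2 \<partial>(M \<Otimes>\<^sub>M M))"
proof -
  interpret prob_space M by fact
  interpret finite_measure_subalgebra M F by unfold_locales (fact sub)
  define Y where "Y = vec_cond_exp M F X"
  define D where "D i w = X w i - Y w i" for i w
  define S where "S i j = (\<integral>w. D i w * D j w \<partial>M)" for i j
  have one: "AE_bounded M (\<lambda>w. 1)" by (rule AE_boundedI[where B = 1]) auto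
  have Xint: "integrable M (\<lambda>w. X w i)" if "i < m" for i
    using integrable_mult_AE_bounded[OF X[OF that] one] by simp
  have YF: "(\<lambda>w. Y w i) \<in> borel_measurable F" for i
    unfolding Y_def vec_cond_exp_def by (rule borel_measurable_cond_exp)
  have Y: "AE_bounded M (\<lambda>w. Y w i)" if i: "i < m" for i
  proof -
    obtain B where "AE w in M. \<bar>X w i\<bar> \<le> B" using X[OF i] unfolding AE_bounded_def by blast
    then have "AE w in M. - B \<le> X w i" "AE w in M. X w i \<le> B" by (eventually_elim, linarith)+
    from real_cond_exp_ge_c[OF Xint[OF i] this(1)] real_cond_exp_le_c[OF Xint[OF i] this(2)]
    have "AE w in M. \<bar>Y w i\<bar> \<le> B"
      unfolding Y_def vec_cond_exp_def by eventually_elim linarith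
    then show ?thesis by (rule AE_boundedI[OF measurable_from_subalg[OF sub YF]])
  qed
  have D: "AE_bounded M (D i)" if "i < m" for i
    unfolding D_def using AE_bounded_diff[OF X Y] that by blast
  note int = integrable_mult_AE_bounded
  have orth: "(\<integral>w. D i w * g w \<partial>M) = 0"
    if i: "i < m" and g: "g \<in> borel_measurable F" "AE_bounded M g" for i g
  proof -
    have "(\<integral>w. g w * Y w i \<partial>M) = (\<integral>w. g w * X w i \<partial>M)"
      unfolding Y_def vec_cond_exp_def
      using X[OF i] by (intro real_cond_exp_intg(2) int g) (auto simp: AE_bounded_def)
    then show ?thesis
      unfolding D_def using int[OF g(2) X[OF i]] int[OF g(2) Y[OF i]]
      by (simp add: right_diff_distrib left_diff_distrib mult.commute)
  qed
  \<comment> \<open>Since \<open>D\<close> is orthogonal to \<open>Y\<close>, the factor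
    \<open>D j\<close> may be replaced by \<open>X\<close>; this makes \<open>W\<close> pair with
    the kernel of \<open>X\<close> as it pairs with itself.\<close>
  have DX: "(\<integral>w. D i w * X w j \<partial>M) = S i j" if "i < m" "j < m" for i j
  proof -
    have "S i j = (\<integral>w. D i w * X w j - D i w * Y w j \<partial>M)"
      unfolding S_def D_def[of j] by (simp add: right_diff_distrib)
    then show ?thesis using that orth[OF that(1) YF Y[OF that(2)]] int[OF D X] int[OF D Y] by simp
  qed
  \<comment> \<open>The law of total covariance: \<open>X\<close> and \<open>Y\<close> have equal
    means, and \<open>Y\<close> has the same mixed moments with \<open>X\<close> as with itself, so
    the difference is the second moment matrix of \<open>D\<close>.\<close>
  have cov: "covariance_matrix M X i j - covariance_matrix M Y i j = S i j" if ij: "i < m" "j < m" for i j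
  proof -
    have EY: "(\<integral>w. Y w l \<partial>M) = (\<integral>w. X w l \<partial>M)" if "l < m" for l
      unfolding Y_def vec_cond_exp_def using real_cond_exp_int(2)[OF Xint[OF that]] .
    have "(\<integral>w. D j w * Y w i \<partial>M) = 0" by (rule orth[OF ij(2) YF Y[OF ij(1)]])
    then have "(\<integral>w. Y w i * X w j \<partial>M) = (\<integral>w. Y w i * Y w j \<partial>M)"
      unfolding D_def using int[OF X[OF ij(2)] Y[OF ij(1)]] int[OF Y[OF ij(2)] Y[OF ij(1)]]
      by (simp add: right_diff_distrib left_diff_distrib mult.commute)
    moreover have "S i j = (\<integral>w. X w i * X w j \<partial>M) - (\<integral>w. Y w i * X w j \<partial>M)"
      unfolding DX[OF ij, symmetric] D_def using int[OF X[OF ij(1)] X[OF ij(2)]] int[OF Y[OF ij(1)] X[OF ij(2)]]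
      by (simp add: left_diff_distrib)
    ultimately show ?thesis
      using ij EY by (simp add: covariance_matrix_alt X Y)
  qed
  define s where "s = (\<Sum>i<m. \<Sum>j<m. (S i j)\<^sup>2)"
  let ?M = "M \<Otimes>\<^sub>M M"
  define W where "W p = (\<Sum>i<m. D i (fst p) * D i (snd p))" for p
  define K where "K p = (\<Sum>i<m. X (fst p) i * X (snd p) i)" for p
  define H where "H p = (\<Sum>l\<in>J. f l (fst p) * h l (snd p))" for p
  note ti = integrable_tensor_sums and te = integral_tensor_sums_eq
  have DD: "integrable M (\<lambda>w. D i w * D j w)" if "i \<in> {..<m}" "j \<in> {..<m}" for i j
    using int[OF D D] that by simp
  have DX_int: "integrable M (\<lambda>w. D i w * X w j)" if "i \<in> {..<m}" "j \<in> {..<m}" for i j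
    using int[OF D X] that by simp
  have XX: "integrable M (\<lambda>w. X w i * X w j)" if "i \<in> {..<m}" "j \<in> {..<m}" for i j
    using int[OF X X] that by simp
  have Df: "integrable M (\<lambda>w. D i w * f l w)" if "i \<in> {..<m}" "l \<in> J" for i l
    using int[OF D f(2)] that by simp
  have Xf: "integrable M (\<lambda>w. X w i * f l w)" if "i \<in> {..<m}" "l \<in> J" for i l
    using int[OF X f(2)] that by simp
  have ff: "integrable M (\<lambda>w. f l w * f l' w)" if "l \<in> J" "l' \<in> J" for l l'
    using int[OF f(2) f(2)] that by simp
  have Dh: "integrable M (\<lambda>w. D i w * h l w)" if "i \<in> {..<m}" "l \<in> J" for i l
    using int[OF D h(2)] that by simp
  have Xh: "integrable M (\<lambda>w. X w i * h l w)" if "i \<in> {..<m}" "l \<in> J" for i l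
    using int[OF X h(2)] that by simp
  have hh: "integrable M (\<lambda>w. h l w * h l' w)" if "l \<in> J" "l' \<in> J" for l l'
    using int[OF h(2) h(2)] that by simp
  have WW: "integrable ?M (\<lambda>p. W p * W p)" "(\<integral>p. W p * W p \<partial>?M) = s"
    unfolding W_def s_def using ti[where I = "{..<m}" and F = D and G = D and J = "{..<m}" and F' = D and G' = D] te[where I = "{..<m}" and F = D and G = D and J = "{..<m}" and F' = D and G' = D] DD
    by (simp_all add: S_def power2_eq_square)
  have WK: "integrable ?M (\<lambda>p. W p * K p)" "(\<integral>p. W p * K p \<partial>?M) = s"
    unfolding W_def K_def s_def using ti[where I = "{..<m}" and F = D and G = D and J = "{..<m}" and F' = "\<lambda>i w. X w i" and G' = "\<lambda>i w. X w i"] te[where I = "{..<m}" and F = D and G = D and J = "{..<m}" and F' = "\<lambda>i w. X w i" and G' = "\<lambda>i w. X w i"] DX_int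
    by (simp_all add: DX power2_eq_square)
  have WH: "integrable ?M (\<lambda>p. W p * H p)" "(\<integral>p. W p * H p \<partial>?M) = 0"
    unfolding W_def H_def using ti[where I = "{..<m}" and F = D and G = D and J = J and F' = f and G' = h] te[where I = "{..<m}" and F = D and G = D and J = J and F' = f and G' = h] Df Dh
    by (simp_all add: orth f h)
  have KK: "integrable ?M (\<lambda>p. K p * K p)"
    unfolding K_def using ti[where I = "{..<m}" and F = "\<lambda>i w. X w i" and G = "\<lambda>i w. X w i" and J = "{..<m}" and F' = "\<lambda>i w. X w i" and G' = "\<lambda>i w. X w i"] XX by simp
  have KH: "integrable ?M (\<lambda>p. K p * H p)"
    unfolding K_def H_def using ti[where I = "{..<m}" and F = "\<lambda>i w. X w i" and G = "\<lambda>i w. X w i" and J = J and F' = f and G' = h] Xf Xh by simp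
  have HH: "integrable ?M (\<lambda>p. H p * H p)"
    unfolding H_def using ti[where I = J and F = f and G = h and J = J and F' = f and G' = h] ff hh by simp
  have \<kappa>: "integrable ?M (\<lambda>p. (K p - H p)\<^sup>2)"
  proof -
    have "(\<lambda>p. (K p - H p)\<^sup>2) = (\<lambda>p. K p * K p - 2 * (K p * H p) + H p * H p)"
      by (auto simp: power2_eq_square algebra_simps)
    then show ?thesis using KK KH HH by simp
  qed
  have "0 \<le> (\<integral>p. (W p - (K p - H p))\<^sup>2 \<partial>?M)" by simp
  also have "\<dots> = (\<integral>p. W p * W p - 2 * (W p * K p) + 2 * (W p * H p) + (K p - H p)\<^sup>2 \<partial>?M)"
    by (intro Bochner_Integration.integral_cong refl) (simp add: power2_eq_square algebra_simps)
  also have "\<dots> = s - 2 * s + 2 * 0 + (\<integral>p. (K p - H p)\<^sup>2 \<partial>?M)"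
    using WW WK WH \<kappa> by simp
  finally have "s \<le> (\<integral>p. (K p - H p)\<^sup>2 \<partial>?M)" by simp
  moreover have "(frobenius_norm m (\<lambda>i j. covariance_matrix M X i j - covariance_matrix M Y i j))\<^sup>2 = s"
    unfolding frobenius_norm_def s_def by (simp add: cov sum_nonneg)
  ultimately show ?thesis unfolding Y_def K_def H_def by simp
qed

section \<open>Partitions\<close>

text \<open>Give \<open>v\<close> the weight 1/2 to the power of its l1-norm. On the ball the weight
  is at least \<open>(1/2) ^ L\<close>, while the total weight over a cube factorises into geometric
  sums, each at most 3.\<close>

lemma card_int_l1_ball:
  assumes "finite J"
  shows "finite {v \<in> J \<rightarrow>\<^sub>E UNIV. (\<Sum>i\<in>J. \<bar>v i\<bar>) \<le> int L}" (is "finite ?V")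
    and "card {v \<in> J \<rightarrow>\<^sub>E UNIV. (\<Sum>i\<in>J. \<bar>v i\<bar>) \<le> int L} \<le> 2 ^ L * 3 ^ card J"
proof -
  let ?W = "J \<rightarrow>\<^sub>E {- int L..int L}"
  have geometric: "(\<Sum>a\<in>{- int n..int n}. (1/2::real) ^ nat \<bar>a\<bar>) = 3 - 2 * (1/2) ^ n" for n
  proof (induction n)
    case (Suc n)
    have "{- int (Suc n)..int (Suc n)} = insert (- int (Suc n)) (insert (int (Suc n)) {- int n..int n})"
      by auto
    then have "(\<Sum>a\<in>{- int (Suc n)..int (Suc n)}. (1/2::real) ^ nat \<bar>a\<bar>)
       = (1/2) ^ nat \<bar>- int (Suc n)\<bar> + ((1/2) ^ nat \<bar>int (Suc n)\<bar> + (\<Sum>a\<in>{- int n..int n}. (1/2) ^ nat \<bar>a\<bar>))"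
      by simp
    also have "\<dots> = (1/2) ^ Suc n + ((1/2) ^ Suc n + (3 - 2 * (1/2) ^ n))"
      by (simp only: Suc abs_minus_cancel abs_of_nat nat_int)
    also have "\<dots> = 3 - 2 * (1/2) ^ Suc n" by simp
    finally show ?case .
  qed simp
  have sub: "?V \<subseteq> ?W"
  proof
    fix v assume v: "v \<in> ?V"
    have "v i \<in> {- int L..int L}" if "i \<in> J" for i
    proof -
      have "\<bar>v i\<bar> \<le> (\<Sum>i\<in>J. \<bar>v i\<bar>)"
        using that assms by (intro member_le_sum) auto
      also have "\<dots> \<le> int L" using v by simp
      finally show ?thesis by auto
    qed
    moreover have "v \<in> extensional J" using v by (simp add: PiE_iff)
    ultimately show "v \<in> ?W" unfolding PiE_iff by blast
  qed
  have fin: "finite ?W" using assms by (intro finite_PiE) auto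
  show finV: "finite ?V" by (rule finite_subset[OF sub fin])
  have "real (card ?V) * (1/2) ^ L = (\<Sum>v\<in>?V. (1/2) ^ L)" by simp
  also have "\<dots> \<le> (\<Sum>v\<in>?V. \<Prod>i\<in>J. (1/2) ^ nat \<bar>v i\<bar>)"
  proof (intro sum_mono)
    fix v assume v: "v \<in> ?V"
    have "int (\<Sum>i\<in>J. nat \<bar>v i\<bar>) = (\<Sum>i\<in>J. \<bar>v i\<bar>)" by simp
    moreover have "(\<Sum>i\<in>J. \<bar>v i\<bar>) \<le> int L" using v by blast
    ultimately have "(\<Sum>i\<in>J. nat \<bar>v i\<bar>) \<le> L" by (metis of_nat_le_iff)
    then show "(1/2::real) ^ L \<le> (\<Prod>i\<in>J. (1/2) ^ nat \<bar>v i\<bar>)"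
      by (simp add: power_sum[symmetric] power_decreasing)
  qed
  also have "\<dots> \<le> (\<Sum>v\<in>?W. \<Prod>i\<in>J. (1/2) ^ nat \<bar>v i\<bar>)"
    by (intro sum_mono2 fin sub prod_nonneg) auto
  also have "\<dots> = (\<Prod>i\<in>J. \<Sum>a\<in>{- int L..int L}. (1/2) ^ nat \<bar>a\<bar>)"
    using assms by (subst prod_sum_PiE) auto
  also have "\<dots> \<le> (\<Prod>i\<in>J. 3)"
  proof (intro prod_mono conjI)
    have "(1/2::real) ^ L \<le> 1" by (simp add: power_le_one)
    then show "0 \<le> (\<Sum>a\<in>{- int L..int L}. (1/2::real) ^ nat \<bar>a\<bar>)" "(\<Sum>a\<in>{- int L..int L}. (1/2::real) ^ nat \<bar>a\<bar>) \<le> 3"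
      unfolding geometric by simp_all
  qed
  finally have "real (card ?V) \<le> real (2 ^ L * 3 ^ card J)"
    by (simp add: field_simps)
  then show "card ?V \<le> 2 ^ L * 3 ^ card J" by (simp only: of_nat_le_iff)
qed

text \<open>A preimage under a function of the label is a finite union of fibres. This makes the
  features below measurable for the partition.\<close>

lemma fibre_partition:
  fixes \<phi> :: "'a \<Rightarrow> 'b"
  assumes fin: "finite (\<phi> ` space M)"
    and meas: "\<And>l. l \<in> \<phi> ` space M \<Longrightarrow> {x \<in> space M. \<phi> x = l} \<in> sets M"
  obtains P where "partition_on (space M) P" "P \<subseteq> sets M" "finite P" "card P \<le> card (\<phi> ` space M)"
    "\<And>g :: 'b \<Rightarrow> real. (\<lambda>x. g (\<phi> x)) \<in> borel_measurable (sigma (space M) P)"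
proof
  let ?fib = "\<lambda>l. {x \<in> space M. \<phi> x = l}"
  let ?P = "?fib ` (\<phi> ` space M)"
  show "partition_on (space M) ?P"
    by (rule partition_onI) (auto simp: disjnt_def)
  show sub: "?P \<subseteq> sets M" using meas by auto
  show "finite ?P" using fin by (rule finite_imageI)
  show "card ?P \<le> card (\<phi> ` space M)" using fin by (rule card_image_le)
  fix g :: "'b \<Rightarrow> real"
  have Pow: "?P \<subseteq> Pow (space M)" by auto
  show "(\<lambda>x. g (\<phi> x)) \<in> borel_measurable (sigma (space M) ?P)"
  proof (rule measurableI)
    fix A :: "real set"
    have "(\<lambda>x. g (\<phi> x)) -` A \<inter> space M = (\<Union>l\<in>{l \<in> \<phi> ` space M. g l \<in> A}. ?fib l)" by auto
    moreover have "\<dots> \<in> sets (sigma (space M) ?P)"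
      using fin by (intro sets.finite_UN) (auto simp: sets_measure_of[OF Pow])
    ultimately show "(\<lambda>x. g (\<phi> x)) -` A \<inter> space (sigma (space M) ?P) \<in> sets (sigma (space M) ?P)"
      by (simp add: space_measure_of[OF Pow])
  qed simp
qed

lemma inner_square_le_one:
  assumes "L2_set x {..<m} \<le> 1" "L2_set y {..<m} \<le> 1"
  shows "(\<Sum>i<m. x i * y i)\<^sup>2 \<le> 1"
proof -
  have "\<bar>\<Sum>i<m. x i * y i\<bar> \<le> (\<Sum>i<m. \<bar>x i\<bar> * \<bar>y i\<bar>)"
    unfolding abs_mult[symmetric] by (rule sum_abs)
  also have "\<dots> \<le> L2_set x {..<m} * L2_set y {..<m}" by (rule L2_set_mult_ineq)
  also have "\<dots> \<le> 1" using assms by (intro mult_le_one) auto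
  finally show ?thesis by (simp add: abs_square_le_1)
qed

lemma AE_bounded_coordinate:
  assumes sets: "sets \<mu> = sets (borel_Rn m)" and AE: "AE x in \<mu>. L2_set x {..<m} \<le> 1" and i: "i < m"
  shows "AE_bounded \<mu> (\<lambda>x. x i)"
proof (rule AE_boundedI)
  have "(\<lambda>x. x i) \<in> borel_measurable (borel_Rn m)"
    unfolding borel_Rn_def using i by (intro measurable_component_singleton) simp
  then show "(\<lambda>x. x i) \<in> borel_measurable \<mu>" by (simp add: measurable_cong_sets[OF sets refl])
  show "AE x in \<mu>. \<bar>x i\<bar> \<le> 1"
    using AE
    by eventually_elim (use abs_le_L2_set[of "{..<m}" i] i in \<open>force intro: order_trans\<close>)
qed

text \<open>Approximation by the zero kernel: \<open>J\<close> is empty, and inner products of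
  vectors in the unit ball have absolute value at most 1. This settles small
  \<open>k\<close>.\<close>

lemma covariance_loss_le_one:
  assumes prob: "prob_space \<mu>" and sets: "sets \<mu> = sets (borel_Rn m)"
    and AE: "AE x in \<mu>. L2_set x {..<m} \<le> 1" and sub: "subalgebra \<mu> F"
  shows "(frobenius_norm m (\<lambda>i j. covariance_matrix \<mu> (\<lambda>x. x) i j
        - covariance_matrix \<mu> (vec_cond_exp \<mu> F (\<lambda>x. x)) i j))\<^sup>2 \<le> 1"
proof -
  interpret prob_space \<mu> by fact
  note tensor_sums = integrable_tensor_sums and integrable_mult = integrable_mult_AE_bounded
  interpret pair_prob_space \<mu> \<mu> ..
  have "(frobenius_norm m (\<lambda>i j. covariance_matrix \<mu> (\<lambda>x. x) i j
        - covariance_matrix \<mu> (vec_cond_exp \<mu> F (\<lambda>x. x)) i j))\<^sup>2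
     \<le> (\<integral>p. ((\<Sum>i<m. fst p i * snd p i) - (\<Sum>l\<in>({}::nat set). 0 * 0))\<^sup>2 \<partial>(\<mu> \<Otimes>\<^sub>M \<mu>))"
    by (rule covariance_loss_le_kernel_approximation[OF prob sub, where X = "\<lambda>x. x"
        and f = "\<lambda>_ _. 0" and h = "\<lambda>_ _. 0" and J = "{}::nat set"])
      (auto intro: AE_bounded_coordinate[OF sets AE])
  also have "\<dots> \<le> 1"
  proof (rule P.integral_le_const)
    show "integrable (\<mu> \<Otimes>\<^sub>M \<mu>) (\<lambda>p. ((\<Sum>i<m. fst p i * snd p i) - (\<Sum>l\<in>({}::nat set). 0 * 0))\<^sup>2)"
      using tensor_sums[where I = "{..<m}" and J = "{..<m}" and F = "\<lambda>i x. x i" and G = "\<lambda>i x. x i"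
          and F' = "\<lambda>i x. x i" and G' = "\<lambda>i x. x i"]
        integrable_mult[OF AE_bounded_coordinate[OF sets AE] AE_bounded_coordinate[OF sets AE]]
      by (simp add: power2_eq_square)
    show "AE p in \<mu> \<Otimes>\<^sub>M \<mu>. ((\<Sum>i<m. fst p i * snd p i) - (\<Sum>l\<in>({}::nat set). 0 * 0))\<^sup>2 \<le> 1"
      using AE_pair_both[OF AE AE] by eventually_elim (simp add: inner_square_le_one)
  qed
  finally show ?thesis .
qed

text \<open>
  The three quantities kept small by the greedy choice (index \<open>b\<close> of \<open>q\<close>) are the error of the
  kernel approximation and, in either argument, the fluctuation of \<open>\<Sum>\<^sub>i f\<^sub>i\<^sup>2 + h\<^sub>i\<^sup>2\<close>. The latter bounds the mass of
  the points outside \<open>G\<close>, where this sum is too large for the labels \<open>\<phi>\<close> to be counted; there the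
  features are replaced by \<open>0\<close>.
\<close>

lemma covariance_loss_exponential_partition:
  assumes prob: "prob_space \<mu>" and sets: "sets \<mu> = sets (borel_Rn m)"
    and AE: "AE x in \<mu>. L2_set x {..<m} \<le> 1" and n: "n > 0"
  obtains P where "partition_on (space \<mu>) P" "P \<subseteq> sets \<mu>" "finite P" "card P \<le> (2 ^ (394 * n) * 3 ^ n)\<^sup>2"
    "(frobenius_norm m (\<lambda>i j. covariance_matrix \<mu> (\<lambda>x. x) i j
        - covariance_matrix \<mu> (vec_cond_exp \<mu> (sigma (space \<mu>) P) (\<lambda>x. x)) i j))\<^sup>2 \<le> 7058 / n"
proof -
  interpret prob_space \<mu> by fact
  interpret pair_prob_space \<mu> \<mu> ..
  let ?M = "\<mu> \<Otimes>\<^sub>M \<mu>"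
  \<comment> \<open>The bias allowed in the kernel is \<open>1 / n\<close>; squared, it is of lower
    order than the sampling error.\<close>
  have "1 / real n > 0" using n by simp
  from rounded_inner_product[OF this, of m]
  obtain \<Omega> :: "((nat \<Rightarrow> int) \<times> nat \<times> nat) set" and fi hi :: "(nat \<Rightarrow> int) \<times> nat \<times> nat \<Rightarrow> (nat \<Rightarrow> real) \<Rightarrow> int"
  where \<Omega>: "finite \<Omega>" "\<Omega> \<noteq> {}"
    and fi_meas': "\<And>w. fi w \<in> measurable (borel_Rn m) (count_space UNIV)"
    and hi_meas': "\<And>w. hi w \<in> measurable (borel_Rn m) (count_space UNIV)"
    and f4': "\<And>x. (\<Sum>w\<in>\<Omega>. real_of_int (fi w x) ^ 4) \<le> 392 * real (card \<Omega>)"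
    and h4': "\<And>x. (\<Sum>w\<in>\<Omega>. real_of_int (hi w x) ^ 4) \<le> 392 * real (card \<Omega>)"
    and approx': "\<And>x y. L2_set x {..<m} \<le> 1 \<Longrightarrow> L2_set y {..<m} \<le> 1 \<Longrightarrow>
      \<bar>(\<Sum>w\<in>\<Omega>. real_of_int (fi w x) * real_of_int (hi w y)) / card \<Omega> - (\<Sum>j<m. x j * y j)\<bar> \<le> 1 / n"
    by blast
  define f h where "f w x = real_of_int (fi w x)" and "h w x = real_of_int (hi w x)" for w x
  have fi_meas [measurable]: "fi w \<in> measurable \<mu> (count_space UNIV)" for w
    using fi_meas' by (simp add: measurable_cong_sets[OF sets refl])
  have hi_meas [measurable]: "hi w \<in> measurable \<mu> (count_space UNIV)" for w
    using hi_meas' by (simp add: measurable_cong_sets[OF sets refl])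
  have f_meas [measurable]: "f w \<in> borel_measurable \<mu>" for w
    unfolding f_def by (rule measurable_compose[OF fi_meas]) simp
  have h_meas [measurable]: "h w \<in> borel_measurable \<mu>" for w
    unfolding h_def by (rule measurable_compose[OF hi_meas]) simp
  note f4 = f4'[folded f_def] and h4 = h4'[folded h_def] and approx = approx'[folded f_def h_def]

  have c: "real (card \<Omega>) \<ge> 1" using \<Omega> by (simp add: Suc_le_eq card_gt_0_iff)
  \<comment> \<open>A nonzero integer satisfies \<open>\<bar>z\<bar> \<le> z ^ 4\<close>. The
    resulting bound \<open>B\<close> grows with \<open>card \<Omega>\<close>; it certifies
    boundedness and does not enter the final estimate.\<close>
  have bounded_of_sum: "\<bar>real_of_int z\<bar> \<le> B" if "(\<Sum>w\<in>\<Omega>. real_of_int (g w) ^ 4) \<le> B" "w \<in> \<Omega>" "z = g w"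
    for z B w and g :: "_ \<Rightarrow> int"
  proof -
    have "\<bar>z\<bar> \<le> z ^ 4"
    proof (cases "z = 0")
      case False
      then have "1 \<le> \<bar>z\<bar>" by simp
      from self_le_power[OF this, of 4] show ?thesis by (simp add: power_even_abs)
    qed simp
    then have "real_of_int \<bar>z\<bar> \<le> real_of_int (z ^ 4)" by (simp only: of_int_le_iff)
    then have "\<bar>real_of_int z\<bar> \<le> real_of_int z ^ 4" by simp
    also have "\<dots> \<le> (\<Sum>w\<in>\<Omega>. real_of_int (g w) ^ 4)"
      unfolding that(3) using that(2) \<Omega>(1)
      by (intro member_le_sum[where f = "\<lambda>w. real_of_int (g w) ^ 4"]) auto
    finally show ?thesis using that(1) by linarith
  qed
  define B where "B = 392 * real (card \<Omega>)"
  have fB: "\<bar>f w x\<bar> \<le> B" and hB: "\<bar>h w x\<bar> \<le> B" if "w \<in> \<Omega>" for w x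
    unfolding f_def h_def B_def using bounded_of_sum[OF f4' that refl] bounded_of_sum[OF h4' that refl] by auto
  have B1: "B \<ge> 1" unfolding B_def using c by linarith

  \<comment> \<open>Moments of the features and the greedy choice\<close>
  define s where "s w x = (f w x)\<^sup>2 + (h w x)\<^sup>2" for w x
  define a where "a x = (\<Sum>w\<in>\<Omega>. s w x) / card \<Omega>" for x
  define k where "k p = (\<Sum>w\<in>\<Omega>. f w (fst p) * h w (snd p)) / card \<Omega>" for p
  define g where "g b w p = (if b = 0 then f w (fst p) * h w (snd p)
    else if b = 1 then s w (fst p) else s w (snd p))" for b :: nat and w p
  define q where "q b w p = g b w p - (\<Sum>w\<in>\<Omega>. g b w p) / card \<Omega>" for b w p
  let ?I = "{0, 1, 2::nat}"
  \<comment> \<open>Here \<open>393 = 1 + 392 / 2 + 392 / 2\<close>.\<close>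
  have a_le: "a x \<le> 393" for x
  proof -
    have sq: "t\<^sup>2 \<le> (1 + t ^ 4) / 2" for t :: real
      using zero_le_power2[of "t\<^sup>2 - 1"] by (simp add: power2_diff power_mult[symmetric])
    have "(\<Sum>w\<in>\<Omega>. s w x) \<le> (\<Sum>w\<in>\<Omega>. (1 + f w x ^ 4) / 2 + (1 + h w x ^ 4) / 2)"
      unfolding s_def by (intro sum_mono add_mono sq)
    also have "\<dots> = real (card \<Omega>) + (\<Sum>w\<in>\<Omega>. f w x ^ 4) / 2 + (\<Sum>w\<in>\<Omega>. h w x ^ 4) / 2"
      by (simp add: sum.distrib sum_divide_distrib[symmetric] add_divide_distrib)
    also have "\<dots> \<le> 393 * real (card \<Omega>)" using f4[of x] h4[of x] by simp
    finally show ?thesis unfolding a_def using c by (simp add: divide_le_eq)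
  qed
  have s2: "(\<Sum>w\<in>\<Omega>. (s w x)\<^sup>2) \<le> 1568 * real (card \<Omega>)" for x
  proof -
    have sq: "(u\<^sup>2 + v\<^sup>2)\<^sup>2 \<le> 2 * u ^ 4 + 2 * v ^ 4" for u v :: real
      using zero_le_power2[of "u\<^sup>2 - v\<^sup>2"] by (simp add: power2_diff power2_sum power_mult[symmetric])
    have "(\<Sum>w\<in>\<Omega>. (s w x)\<^sup>2) \<le> (\<Sum>w\<in>\<Omega>. 2 * f w x ^ 4 + 2 * h w x ^ 4)"
      unfolding s_def by (intro sum_mono sq)
    also have "\<dots> = 2 * (\<Sum>w\<in>\<Omega>. f w x ^ 4) + 2 * (\<Sum>w\<in>\<Omega>. h w x ^ 4)"
      by (simp add: sum.distrib sum_distrib_left)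
    finally show ?thesis using f4[of x] h4[of x] by linarith
  qed
  have fh2: "(\<Sum>w\<in>\<Omega>. (f w x * h w y)\<^sup>2) \<le> 392 * real (card \<Omega>)" for x y
  proof -
    have sq: "(u * v)\<^sup>2 \<le> (u ^ 4 + v ^ 4) / 2" for u v :: real
      using zero_le_power2[of "u\<^sup>2 - v\<^sup>2"] by (simp add: power2_diff power_mult_distrib power_mult[symmetric])
    have "(\<Sum>w\<in>\<Omega>. (f w x * h w y)\<^sup>2) \<le> (\<Sum>w\<in>\<Omega>. (f w x ^ 4 + h w y ^ 4) / 2)"
      by (intro sum_mono sq)
    also have "\<dots> = (\<Sum>w\<in>\<Omega>. f w x ^ 4) / 2 + (\<Sum>w\<in>\<Omega>. h w y ^ 4) / 2"
      by (simp add: sum.distrib sum_divide_distrib[symmetric] add_divide_distrib)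
    finally show ?thesis using f4[of x] h4[of y] by linarith
  qed
  have g2: "(\<Sum>w\<in>\<Omega>. (g b w p)\<^sup>2) \<le> (if b = 0 then 392 else 1568) * real (card \<Omega>)" if "b \<in> ?I" for b p
    unfolding g_def using that fh2[of "fst p" "snd p"] s2[of "fst p"] s2[of "snd p"] by auto
  have q_meas [measurable]: "q b w \<in> borel_measurable ?M" for b w
    unfolding q_def g_def s_def by (cases "b = 0"; cases "b = 1"; simp; measurable)
  \<comment> \<open>The total \<open>3528 = 392 + 2 * 1568\<close> collects the kernel term and one
    fluctuation term for each argument.\<close>
  have q2: "(\<Sum>w\<in>\<Omega>. \<Sum>b\<in>?I. (q b w p)\<^sup>2) \<le> 3528 * real (card \<Omega>)" for p
  proof -
    have "(\<Sum>w\<in>\<Omega>. \<Sum>b\<in>?I. (q b w p)\<^sup>2) = (\<Sum>b\<in>?I. \<Sum>w\<in>\<Omega>. (q b w p)\<^sup>2)" by (rule sum.swap)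
    also have "\<dots> \<le> (\<Sum>b\<in>?I. (if b = 0 then 392 else 1568) * real (card \<Omega>))"
      unfolding q_def by (intro sum_mono order_trans[OF sum_squared_deviation_le[OF \<Omega>] g2])
    finally show ?thesis by simp
  qed
  have q_sq_bound: "(q b w p)\<^sup>2 \<le> 1568 * real (card \<Omega>)" if "b \<in> ?I" "w \<in> \<Omega>" for b w p
  proof -
    have "(q b w p)\<^sup>2 \<le> (\<Sum>w\<in>\<Omega>. (q b w p)\<^sup>2)"
      using that \<Omega>(1) by (intro member_le_sum) auto
    also have "\<dots> \<le> (\<Sum>w\<in>\<Omega>. (g b w p)\<^sup>2)" unfolding q_def by (rule sum_squared_deviation_le[OF \<Omega>])
    also have "\<dots> \<le> 1568 * real (card \<Omega>)" using g2[OF that(1), of p] by (auto split: if_splits)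
    finally show ?thesis .
  qed
  have q_bound: "\<bar>q b w p\<bar> \<le> 1568 * real (card \<Omega>)" if "b \<in> ?I" "w \<in> \<Omega>" for b w p
  proof -
    have "1 \<le> 1568 * real (card \<Omega>)" using c by linarith
    then have "1568 * real (card \<Omega>) \<le> (1568 * real (card \<Omega>))\<^sup>2" by (rule self_le_power) simp
    with q_sq_bound[OF that, of p] have "\<bar>q b w p\<bar>\<^sup>2 \<le> (1568 * real (card \<Omega>))\<^sup>2"
      unfolding power2_abs by (rule order_trans)
    then show ?thesis by (rule power2_le_imp_le) simp
  qed
  have q_int: "integrable ?M (\<lambda>p. (q b w p)\<^sup>2)" if "b \<in> ?I" "w \<in> \<Omega>" for b w
    by (rule P.integrable_const_bound[where B = "1568 * real (card \<Omega>)"]) (use q_sq_bound[OF that] in auto)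
  have "\<exists>\<sigma>. (\<forall>i. \<sigma> i \<in> \<Omega>) \<and> (\<Sum>b\<in>?I. \<integral>p. (\<Sum>i<n. q b (\<sigma> i) p)\<^sup>2 \<partial>?M) \<le> real n * 3528"
  proof (rule greedy_selection[where M = ?M and q = q and I = ?I and n = n and c = 3528
        and B = "1568 * real (card \<Omega>)" and \<Omega> = \<Omega>])
    show "(\<Sum>w\<in>\<Omega>. q b w p) = 0" for b p unfolding q_def by (rule sum_deviation_eq_0[OF \<Omega>])
    have "(\<Sum>w\<in>\<Omega>. \<Sum>b\<in>?I. \<integral>p. (q b w p)\<^sup>2 \<partial>?M) = (\<integral>p. (\<Sum>w\<in>\<Omega>. \<Sum>b\<in>?I. (q b w p)\<^sup>2) \<partial>?M)"
      using q_int by (simp add: Bochner_Integration.integral_sum Bochner_Integration.integrable_sum)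
    also have "\<dots> \<le> 3528 * real (card \<Omega>)"
      by (rule P.integral_le_const) (use q_int q2 in \<open>auto intro!: Bochner_Integration.integrable_sum\<close>)
    finally show "(\<Sum>w\<in>\<Omega>. \<Sum>b\<in>?I. \<integral>p. (q b w p)\<^sup>2 \<partial>?M) \<le> real (card \<Omega>) * 3528" by (simp add: mult.commute)
  qed (use \<Omega> q_bound P.finite_measure_axioms in auto)
  then obtain \<sigma> where \<sigma>: "\<And>i. \<sigma> i \<in> \<Omega>"
    and R_le: "(\<Sum>b\<in>?I. \<integral>p. (\<Sum>i<n. q b (\<sigma> i) p)\<^sup>2 \<partial>?M) \<le> real n * 3528" by blast
  define R where "R b p = (\<Sum>i<n. q b (\<sigma> i) p)" for b p
  have R_int: "integrable ?M (\<lambda>p. (R b p)\<^sup>2)" if b: "b \<in> ?I" for b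
  proof (rule P.integrable_const_bound[where B = "(n * (1568 * real (card \<Omega>)))\<^sup>2"])
    have "\<bar>R b p\<bar> \<le> (\<Sum>i<n. 1568 * real (card \<Omega>))" for p
      unfolding R_def by (intro order_trans[OF sum_abs] sum_mono q_bound b \<sigma>)
    then show "AE p in ?M. norm ((R b p)\<^sup>2) \<le> (n * (1568 * real (card \<Omega>)))\<^sup>2"
      by (auto intro!: abs_le_square_iff[THEN iffD1])
  qed (simp add: R_def)

  \<comment> \<open>Truncated features and the partition by their values\<close>
  \<comment> \<open>The threshold exceeds \<open>n\<close> times the mean bound 393 by a margin of
    \<open>n\<close>, so a point outside \<open>G\<close> forces a fluctuation of size at least
    \<open>n\<close>.\<close>
  define G where "G x \<longleftrightarrow> (\<Sum>i<n. (fi (\<sigma> i) x)\<^sup>2 + (hi (\<sigma> i) x)\<^sup>2) \<le> 394 * int n" for x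
  define fG hG where "fG i x = (if G x then fi (\<sigma> i) x else 0)"
    and "hG i x = (if G x then hi (\<sigma> i) x else 0)" for i x
  define \<phi> where "\<phi> x = (restrict (\<lambda>i. fG i x) {..<n}, restrict (\<lambda>i. hG i x) {..<n})" for x
  have G_iff: "G x \<longleftrightarrow> (\<Sum>i<n. s (\<sigma> i) x) \<le> 394 * n" for x
  proof -
    have "(\<Sum>i<n. s (\<sigma> i) x) = real_of_int (\<Sum>i<n. (fi (\<sigma> i) x)\<^sup>2 + (hi (\<sigma> i) x)\<^sup>2)"
      unfolding s_def f_def h_def by simp
    moreover have "G x \<longleftrightarrow> real_of_int (\<Sum>i<n. (fi (\<sigma> i) x)\<^sup>2 + (hi (\<sigma> i) x)\<^sup>2) \<le> real_of_int (394 * int n)"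
      unfolding G_def by (simp only: of_int_le_iff)
    moreover have "real_of_int (394 * int n) = 394 * n" by simp
    ultimately show ?thesis by (simp only:)
  qed
  let ?V = "{v \<in> {..<n} \<rightarrow>\<^sub>E UNIV. (\<Sum>i<n. \<bar>v i\<bar>) \<le> int (394 * n)}"
  \<comment> \<open>Integrality turns the quadratic bound in \<open>G\<close> into an l1-bound on
    the labels, which leaves exponentially many in \<open>n\<close>.\<close>
  have int_sq: "\<bar>t\<bar> \<le> t\<^sup>2" for t :: int
  proof (cases "t = 0")
    case False
    then have "1 \<le> \<bar>t\<bar>" by simp
    from self_le_power[OF this, of 2] show ?thesis by simp
  qed simp
  have fG_le: "(\<Sum>i<n. \<bar>fG i x\<bar>) \<le> int (394 * n)" and hG_le: "(\<Sum>i<n. \<bar>hG i x\<bar>) \<le> int (394 * n)" for x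
  proof -
    show "(\<Sum>i<n. \<bar>fG i x\<bar>) \<le> int (394 * n)"
    proof (cases "G x")
      case True
      have "(\<Sum>i<n. \<bar>fG i x\<bar>) \<le> (\<Sum>i<n. (fi (\<sigma> i) x)\<^sup>2 + (hi (\<sigma> i) x)\<^sup>2)"
        unfolding fG_def using True by (intro sum_mono) (simp add: add_increasing2 int_sq)
      then show ?thesis using True unfolding G_def by simp
    qed (simp add: fG_def)
    show "(\<Sum>i<n. \<bar>hG i x\<bar>) \<le> int (394 * n)"
    proof (cases "G x")
      case True
      have "(\<Sum>i<n. \<bar>hG i x\<bar>) \<le> (\<Sum>i<n. (fi (\<sigma> i) x)\<^sup>2 + (hi (\<sigma> i) x)\<^sup>2)"
        unfolding hG_def using True by (intro sum_mono) (simp add: add_increasing int_sq)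
      then show ?thesis using True unfolding G_def by simp
    qed (simp add: hG_def)
  qed
  have V: "finite ?V" "card ?V \<le> 2 ^ (394 * n) * 3 ^ n"
    using card_int_l1_ball[of "{..<n}" "394 * n"] by auto
  have "\<phi> x \<in> ?V \<times> ?V" for x
    unfolding \<phi>_def using fG_le[of x] hG_le[of x] by simp
  then have img: "\<phi> ` space \<mu> \<subseteq> ?V \<times> ?V" by blast
  have fin: "finite (\<phi> ` space \<mu>)" by (rule finite_subset[OF img]) (use V(1) in blast)
  have "card (\<phi> ` space \<mu>) \<le> card (?V \<times> ?V)"
    by (rule card_mono[OF _ img]) (use V(1) in blast)
  also have "\<dots> \<le> (2 ^ (394 * n) * 3 ^ n)\<^sup>2"
    unfolding card_cartesian_product power2_eq_square by (intro mult_mono V) auto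
  finally have card_\<phi>: "card (\<phi> ` space \<mu>) \<le> (2 ^ (394 * n) * 3 ^ n)\<^sup>2" .
  have G_meas: "{x \<in> space \<mu>. G x} \<in> sets \<mu>"
  proof -
    have "(\<lambda>x. \<Sum>i<n. s (\<sigma> i) x) \<in> borel_measurable \<mu>" unfolding s_def by measurable
    then show ?thesis unfolding G_iff borel_measurable_iff_le by blast
  qed
  have fG_meas: "fG i \<in> measurable \<mu> (count_space UNIV)" for i
    unfolding fG_def using G_meas by (intro measurable_If fi_meas) auto
  have hG_meas: "hG i \<in> measurable \<mu> (count_space UNIV)" for i
    unfolding hG_def using G_meas by (intro measurable_If hi_meas) auto
  have fibre: "{x \<in> space \<mu>. \<phi> x = l} \<in> sets \<mu>" if l: "l \<in> \<phi> ` space \<mu>" for l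
  proof -
    have "l \<in> ({..<n} \<rightarrow>\<^sub>E UNIV) \<times> ({..<n} \<rightarrow>\<^sub>E UNIV)" using l img by auto
    then have "\<phi> x = l \<longleftrightarrow> (\<forall>i\<in>{..<n}. fG i x = fst l i \<and> hG i x = snd l i)" for x
      unfolding \<phi>_def by (cases l) (auto simp: fun_eq_iff PiE_iff extensional_def restrict_def)
    moreover have "{x \<in> space \<mu>. \<forall>i\<in>{..<n}. fG i x = fst l i \<and> hG i x = snd l i} \<in> sets \<mu>"
      using measurable_sets[OF fG_meas, of "{_}"] measurable_sets[OF hG_meas, of "{_}"]
      by (intro sets.sets_Collect_finite_All sets.sets_Collect_conj) (auto simp: vimage_def Int_def conj_commute)
    ultimately show ?thesis by simp
  qed
  from fibre_partition[OF fin fibre] obtain P where P: "partition_on (space \<mu>) P" "P \<subseteq> sets \<mu>"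
    "finite P" "card P \<le> card (\<phi> ` space \<mu>)"
    and P_meas: "\<And>g. (\<lambda>x. g (\<phi> x) :: real) \<in> borel_measurable (sigma (space \<mu>) P)" by blast
  define F where "F = sigma (space \<mu>) P"
  have Pow: "P \<subseteq> Pow (space \<mu>)" using P(2) sets.space_closed by blast
  have sub: "subalgebra \<mu> F"
    unfolding F_def using P(2) Pow by (simp add: subalgebra_def sets.sigma_sets_subset)
  \<comment> \<open>The factor \<open>1 / n\<close> of the average kernel is carried by the first
    feature alone.\<close>
  have fGF: "(\<lambda>x. fG i x / n) \<in> borel_measurable F" and hGF: "(\<lambda>x. real_of_int (hG i x)) \<in> borel_measurable F"
    if "i < n" for i
    using P_meas[of "\<lambda>l. fst l i / n"] P_meas[of "\<lambda>l. snd l i"] that unfolding F_def \<phi>_def by simp_all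
  have fG_b: "AE_bounded \<mu> (\<lambda>x. fG i x / n)" if "i < n" for i
  proof (rule AE_boundedI[OF measurable_from_subalg[OF sub fGF[OF that]]])
    have "\<bar>fG i x / n\<bar> \<le> B" for x
    proof -
      have "\<bar>fG i x / n\<bar> \<le> \<bar>real_of_int (fG i x)\<bar>" using n by (simp add: abs_divide divide_le_eq mult_le_cancel_left1)
      also have "\<dots> \<le> B" using fB[OF \<sigma>, of i x] B1 unfolding fG_def f_def by auto
      finally show ?thesis .
    qed
    then show "AE x in \<mu>. \<bar>fG i x / n\<bar> \<le> B" by simp
  qed
  have hG_b: "AE_bounded \<mu> (\<lambda>x. real_of_int (hG i x))" if "i < n" for i
  proof (rule AE_boundedI[OF measurable_from_subalg[OF sub hGF[OF that]]])
    have "\<bar>real_of_int (hG i x)\<bar> \<le> B" for x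
      using hB[OF \<sigma>, of i x] B1 unfolding hG_def h_def by auto
    then show "AE x in \<mu>. \<bar>real_of_int (hG i x)\<bar> \<le> B" by simp
  qed
  let ?err = "\<lambda>p. ((\<Sum>i<m. fst p i * snd p i) - (\<Sum>i\<in>{..<n}. fG i (fst p) / n * hG i (snd p)))\<^sup>2"
  have loss: "(frobenius_norm m (\<lambda>i j. covariance_matrix \<mu> (\<lambda>x. x) i j
        - covariance_matrix \<mu> (vec_cond_exp \<mu> F (\<lambda>x. x)) i j))\<^sup>2 \<le> (\<integral>p. ?err p \<partial>?M)"
    by (rule covariance_loss_le_kernel_approximation[OF prob sub, where X = "\<lambda>x. x" and J = "{..<n}"
        and f = "\<lambda>i x. fG i x / n" and h = "\<lambda>i x. real_of_int (hG i x)"])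
      (auto intro: AE_bounded_coordinate[OF sets AE] fGF hGF fG_b hG_b)

  \<comment> \<open>Pointwise error and its integral\<close>
  have exceed: "(R b p)\<^sup>2 \<ge> (real n)\<^sup>2" if "\<not> G x" "R b p = (\<Sum>i<n. s (\<sigma> i) x - a x)" for b p x
  proof -
    have "R b p = (\<Sum>i<n. s (\<sigma> i) x) - n * a x" using that(2) by (simp add: sum_subtractf)
    moreover have "n * a x \<le> real n * 393" by (intro mult_left_mono a_le) auto
    ultimately have "R b p \<ge> real n" using that(1) unfolding G_iff by (simp add: not_le)
    then show ?thesis by (intro power_mono) auto
  qed
  \<comment> \<open>On good pairs the error splits into the bias and the sampling error
    \<open>R 0 p / n\<close>. On the other pairs the approximating kernel vanishes, the squared
    error is at most 1, and \<open>R 1\<close> or \<open>R 2\<close> is at least \<open>n\<close> in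
    absolute value: Chebyshev's inequality in pointwise form.\<close>
  have err_le: "?err p \<le> 2 * (1 / n)\<^sup>2 + 2 / (real n)\<^sup>2 * (\<Sum>b\<in>?I. (R b p)\<^sup>2)"
    if p: "L2_set (fst p) {..<m} \<le> 1" "L2_set (snd p) {..<m} \<le> 1" for p
  proof (cases "G (fst p) \<and> G (snd p)")
    case True
    define K where "K = (\<Sum>i<m. fst p i * snd p i)"
    have "R 0 p = (\<Sum>i<n. f (\<sigma> i) (fst p) * h (\<sigma> i) (snd p)) - n * k p"
      unfolding R_def q_def g_def k_def by (simp add: sum_subtractf)
    then have "(\<Sum>i\<in>{..<n}. fG i (fst p) / n * hG i (snd p)) = k p + R 0 p / n"
      using True n unfolding fG_def hG_def f_def h_def by (simp add: sum_divide_distrib[symmetric] field_simps)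
    then have "?err p = (K - (k p + R 0 p / n))\<^sup>2" unfolding K_def by (simp only:)
    also have "\<dots> = ((K - k p) + (- (R 0 p / n)))\<^sup>2" by (simp add: diff_diff_eq)
    also have "\<dots> \<le> 2 * (K - k p)\<^sup>2 + 2 * (- (R 0 p / n))\<^sup>2"
      by (rule power2_add_le)
    also have "\<dots> \<le> 2 * (1 / n)\<^sup>2 + 2 / (real n)\<^sup>2 * (R 0 p)\<^sup>2"
    proof (intro add_mono)
      have "\<bar>K - k p\<bar> \<le> 1 / n" using approx[OF p] unfolding K_def k_def by (simp add: abs_minus_commute)
      then show "2 * (K - k p)\<^sup>2 \<le> 2 * (1 / n)\<^sup>2"
        by (intro mult_left_mono power2_le_iff_abs_le[THEN iffD2]) auto
    qed (simp add: power_divide)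
    also have "\<dots> \<le> 2 * (1 / n)\<^sup>2 + 2 / (real n)\<^sup>2 * (\<Sum>b\<in>?I. (R b p)\<^sup>2)"
      by (intro add_left_mono mult_left_mono) auto
    finally show ?thesis .
  next
    case False
    have "R 1 p = (\<Sum>i<n. s (\<sigma> i) (fst p) - a (fst p))" "R 2 p = (\<Sum>i<n. s (\<sigma> i) (snd p) - a (snd p))"
      unfolding R_def q_def g_def a_def by simp_all
    then have "(real n)\<^sup>2 \<le> (R 1 p)\<^sup>2 \<or> (real n)\<^sup>2 \<le> (R 2 p)\<^sup>2" using False exceed by blast
    moreover have "(\<Sum>b\<in>?I. (R b p)\<^sup>2) = (R 0 p)\<^sup>2 + (R 1 p)\<^sup>2 + (R 2 p)\<^sup>2"
      by (simp del: One_nat_def)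
    ultimately have R_ge: "(real n)\<^sup>2 \<le> (\<Sum>b\<in>?I. (R b p)\<^sup>2)"
      using zero_le_power2[of "R 0 p"] zero_le_power2[of "R 1 p"] zero_le_power2[of "R 2 p"] by linarith
    have "fG i (fst p) / n * hG i (snd p) = 0" for i using False unfolding fG_def hG_def by auto
    then have "?err p = (\<Sum>i<m. fst p i * snd p i)\<^sup>2" by (simp only: sum.neutral_const diff_zero)
    also have "\<dots> \<le> 1" by (rule inner_square_le_one[OF p])
    also have "\<dots> = 1 / (real n)\<^sup>2 * (real n)\<^sup>2" using n by simp
    also have "\<dots> \<le> 2 / (real n)\<^sup>2 * (\<Sum>b\<in>?I. (R b p)\<^sup>2)" by (intro mult_mono R_ge divide_right_mono) auto
    also have "\<dots> \<le> 2 * (1 / n)\<^sup>2 + 2 / (real n)\<^sup>2 * (\<Sum>b\<in>?I. (R b p)\<^sup>2)" by simp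
    finally show ?thesis .
  qed
  have R_sum_int: "integrable ?M (\<lambda>p. 2 / (real n)\<^sup>2 * (\<Sum>b\<in>?I. (R b p)\<^sup>2))"
    using R_int by (intro integrable_mult_right Bochner_Integration.integrable_sum) auto
  have "(\<integral>p. ?err p \<partial>?M) \<le> (\<integral>p. 2 * (1 / n)\<^sup>2 + 2 / (real n)\<^sup>2 * (\<Sum>b\<in>?I. (R b p)\<^sup>2) \<partial>?M)"
  proof (rule integral_mono_AE')
    show "integrable ?M (\<lambda>p. 2 * (1 / n)\<^sup>2 + 2 / (real n)\<^sup>2 * (\<Sum>b\<in>?I. (R b p)\<^sup>2))"
      by (rule Bochner_Integration.integrable_add[OF P.integrable_const R_sum_int])
    show "AE p in ?M. ?err p \<le> 2 * (1 / n)\<^sup>2 + 2 / (real n)\<^sup>2 * (\<Sum>b\<in>?I. (R b p)\<^sup>2)"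
      using AE_pair_both[OF AE AE] by eventually_elim (intro err_le; simp)
  qed simp
  also have "\<dots> = 2 * (1 / n)\<^sup>2 + 2 / (real n)\<^sup>2 * (\<Sum>b\<in>?I. \<integral>p. (R b p)\<^sup>2 \<partial>?M)"
    using R_int
    by (subst Bochner_Integration.integral_add[OF P.integrable_const R_sum_int]) (simp add: P.prob_space)
  also have "\<dots> \<le> 2 * (1 / n)\<^sup>2 + 2 / (real n)\<^sup>2 * (real n * 3528)"
    using R_le unfolding R_def by (intro add_left_mono mult_left_mono) auto
  \<comment> \<open>The first term uses \<open>n \<ge> 1\<close>; the second is
    \<open>7056 = 2 * 3528\<close>.\<close>
  also have "\<dots> \<le> 2 / n + 7056 / n"
    using n by (intro add_mono) (auto simp: power2_eq_square field_simps)
  finally have "(\<integral>p. ?err p \<partial>?M) \<le> 7058 / n" by simp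
  with loss have "(frobenius_norm m (\<lambda>i j. covariance_matrix \<mu> (\<lambda>x. x) i j
        - covariance_matrix \<mu> (vec_cond_exp \<mu> F (\<lambda>x. x)) i j))\<^sup>2 \<le> 7058 / n" by linarith
  then show thesis
    using P card_\<phi> unfolding F_def by (intro that[of P]) auto
qed

theorem theorem1p1:
  shows "\<exists>C::real. C > 0 \<and>
    (\<forall>(m::nat) (\<mu> :: (nat \<Rightarrow> real) measure).
       m \<ge> 1 \<longrightarrow> prob_space \<mu> \<longrightarrow> sets \<mu> = sets (borel_Rn m) \<longrightarrow>
       (AE x in \<mu>. L2_set x {..<m} \<le> 1) \<longrightarrow>
       (\<forall>k::nat. k \<ge> 3 \<longrightarrow>
          (\<exists>P. partition_on (space (borel_Rn m)) P \<and> P \<subseteq> sets (borel_Rn m) \<and>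
             finite P \<and> card P \<le> k \<and>
             (let X = (\<lambda>x. x);
                  F = sigma (space \<mu>) P;
                  Y = vec_cond_exp \<mu> F X
              in frobenius_norm m
                   (\<lambda>i j. covariance_matrix \<mu> X i j - covariance_matrix \<mu> Y i j)
                 \<le> C / sqrt (ln (real k))))))"
proof -
  \<comment> \<open>\<open>n\<close> samples give at most \<open>Q ^ n\<close> parts; the outer
    square counts the pairs of labels, one for \<open>f\<close> and one for
    \<open>h\<close>.\<close>
  obtain Q :: nat where Q: "Q = (2 ^ 394 * 3)\<^sup>2" by blast
  have "2 * 2 \<le> Q" unfolding Q power2_eq_square
    by (intro mult_mono order_trans[OF self_le_power[of 2 394]]) auto
  then have "real Q > 1" by simp
  then have lnQ: "ln (real Q) > 0" by simp
  \<comment> \<open>\<open>14116 = 2 * 7058\<close>, the factor 2 paying for rounding the number of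
    samples down.\<close>
  define C where "C = sqrt (14116 * ln (real Q))"
  have C2: "C\<^sup>2 = 14116 * ln (real Q)" and C: "C > 0" unfolding C_def using lnQ by simp_all
  show ?thesis
    unfolding Let_def
  proof (intro exI[of _ C] conjI allI impI C)
    fix m :: nat and \<mu> :: "(nat \<Rightarrow> real) measure" and k :: nat
    assume prob: "prob_space \<mu>" and sets: "sets \<mu> = sets (borel_Rn m)"
      and AE: "AE x in \<mu>. L2_set x {..<m} \<le> 1" and k: "3 \<le> k"
    interpret prob_space \<mu> by fact
    have space: "space \<mu> = space (borel_Rn m)" using sets by (rule sets_eq_imp_space_eq)
    have lnk: "ln (real k) > 0" using k by simp
    let ?loss = "\<lambda>P. frobenius_norm m (\<lambda>i j. covariance_matrix \<mu> (\<lambda>x. x) i j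
        - covariance_matrix \<mu> (vec_cond_exp \<mu> (sigma (space \<mu>) P) (\<lambda>x. x)) i j)"
    obtain P where P: "partition_on (space \<mu>) P" "P \<subseteq> sets \<mu>" "finite P" "card P \<le> k"
      and loss: "(?loss P)\<^sup>2 \<le> 14116 * ln (real Q) / ln (real k)"
    proof (cases "Q \<le> k")
      case True
      \<comment> \<open>The largest number of samples with \<open>Q ^ n \<le> k\<close>.\<close>
      define n where "n = nat \<lfloor>ln (real k) / ln (real Q)\<rfloor>"
      have ratio: "1 \<le> ln (real k) / ln (real Q)"
        using lnQ True \<open>real Q > 1\<close> by simp
      then have "1 \<le> \<lfloor>ln (real k) / ln (real Q)\<rfloor>" by simp
      then have n: "n > 0" "real n \<le> ln (real k) / ln (real Q)" "ln (real k) / ln (real Q) < real n + 1"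
        unfolding n_def by linarith+
      have "real n * ln (real Q) \<le> ln (real k)" using n(2) lnQ by (simp add: field_simps)
      then have "ln (real Q ^ n) \<le> ln (real k)" using \<open>real Q > 1\<close> by (simp add: ln_realpow)
      then have "real Q ^ n \<le> real k" using \<open>real Q > 1\<close> k by simp
      then have "real (Q ^ n) \<le> real k" by simp
      then have "Q ^ n \<le> k" by (simp only: of_nat_le_iff)
      moreover have "(2 ^ (394 * n) * 3 ^ n)\<^sup>2 = Q ^ n"
        unfolding Q by (simp only: power_mult power_mult_distrib[symmetric] power_commutes)
          (simp only: power_mult[symmetric] mult.commute)
      ultimately have card: "(2 ^ (394 * n) * 3 ^ n)\<^sup>2 \<le> k" by (simp only:)
      have "ln (real k) \<le> 2 * real n * ln (real Q)"
      proof -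
        \<comment> \<open>The quotient is below \<open>n + 1\<close>, and
          \<open>n + 1 \<le> 2 * n\<close> because \<open>n\<close> is positive.\<close>
        have "ln (real k) / ln (real Q) \<le> 2 * real n" using n(1,3) by linarith
        then show ?thesis using lnQ by (simp add: field_simps)
      qed
      then have "7058 / real n \<le> 14116 * ln (real Q) / ln (real k)"
        using n(1) lnk by (simp add: field_simps)
      note le = this
      show ?thesis
      proof (rule covariance_loss_exponential_partition[OF prob sets AE n(1)])
        fix P assume P: "partition_on (space \<mu>) P" "P \<subseteq> sets \<mu>" "finite P"
          "card P \<le> (2 ^ (394 * n) * 3 ^ n)\<^sup>2" "(?loss P)\<^sup>2 \<le> 7058 / n"
        show ?thesis
          by (rule that[OF P(1-3) order_trans[OF P(4) card] order_trans[OF P(5) le]])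
      qed
    next
      case False
      \<comment> \<open>Too few parts for a single sample: the trivial partition has squared loss at
        most 1, and \<open>k < Q\<close> makes the claimed bound exceed 1.\<close>
      have "subalgebra \<mu> (sigma (space \<mu>) {space \<mu>})"
        by (simp add: subalgebra_def sets.sigma_sets_subset)
      then have "(?loss {space \<mu>})\<^sup>2 \<le> 1" by (rule covariance_loss_le_one[OF prob sets AE])
      also have "1 \<le> ln (real Q) / ln (real k)" using False k lnk by simp
      also have "\<dots> \<le> 14116 * ln (real Q) / ln (real k)"
        using lnQ lnk by (intro divide_right_mono) auto
      finally show ?thesis
        using k not_empty by (intro that[of "{space \<mu>}"]) (auto intro: partition_on_space)
    qed
    have "?loss P \<le> C / sqrt (ln (real k))"
    proof (rule power2_le_imp_le)
      show "(?loss P)\<^sup>2 \<le> (C / sqrt (ln (real k)))\<^sup>2"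
        using loss lnk by (simp add: power_divide C2)
    qed (use C lnk in simp)
    then show "\<exists>P. partition_on (space (borel_Rn m)) P \<and> P \<subseteq> sets (borel_Rn m) \<and>
        finite P \<and> card P \<le> k \<and> ?loss P \<le> C / sqrt (ln (real k))"
      using P unfolding space sets by blast
  qed
qed

end
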